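(* Let $\vec{\rho}_1=\{\rho_1^n\}_{n\in\mathbb{N}}$, $\vec{\sigma}_1=\{\sigma_1^n\}_{n\in\mathbb{N}}$, $\vec{\rho}_2=\{\rho_2^n\}_{n\in\mathbb{N}}$, $\vec{\sigma}_2=\{\sigma_2^n\}_{n\in\mathbb{N}}$ be sequences of states with $\rho_1^n,\sigma_1^n$ density operators on $\mathbb{C}^{d_1^n}$ and $\rho_2^n,\sigma_2^n$ density operators on $\mathbb{C}^{d_2^n}$ (arbitrary dimensions), such that for $i\in\{1,2\}$ the limits $\tilde D_\alpha(\vec{\rho}_i\|\vec{\sigma}_i) := \lim_{n\to\infty}\frac1n \tilde D_\alpha(\rho_i^n\|\sigma_i^n)$ exist and are continuous in $\alpha$ at $\alpha=1$. Write $D(\vec{\rho}_i\|\vec{\sigma}_i):=\tilde D_1(\vec{\rho}_i\|\vec{\sigma}_i)$ and suppose $D(\vec{\rho}_1\|\vec{\sigma}_1) < D(\vec{\rho}_2\|\vec{\sigma}_2)$. Let $\Delta\in\{T,P\}$. Then there exists $\gamma>0$ such that for every sequence of quantum channels $\{\mathcal{E}_n\}_{n\in\mathbb{N}}$ satisfying $\mathcal{E}_n(\sigma_1^n)=\sigma_2^n$ there exists $n_0\in\mathbb{N}$ such that for all $n\ge n_0$, $\Delta(\mathcal{E}_n(\rho_1^n),\rho_2^n)\ge 1-2^{-\gamma n}$.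
   Context: Logarithms are base 2; quantum channels are completely positive trace-preserving maps. The sandwiched Rényi divergence for $\alpha\in[\frac12,1)\cup(1,\infty)$ is $\tilde D_\alpha(\rho\|\sigma)=\frac{1}{\alpha-1}\log\mathrm{tr}\big(\sigma^{\frac{1-\alpha}{2\alpha}}\rho\,\sigma^{\frac{1-\alpha}{2\alpha}}\big)^\alpha$, and $\tilde D_1(\rho\|\sigma)=D(\rho\|\sigma)=\mathrm{tr}\,\rho(\log\rho-\log\sigma)$ is the quantum relative entropy. Trace distance $T(\rho,\sigma)=\frac12\|\rho-\sigma\|_1$; purified distance $P(\rho,\sigma)=\sqrt{1-\|\sqrt\rho\sqrt\sigma\|_1^2}$. Standing assumption of the paper: the states $\sigma$ have full support. *)

theory Defs
  imports Complex_Main "Jordan_Normal_Form.Schur_Decomposition"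
begin

definition mtrace :: "complex mat \<Rightarrow> complex" where
  "mtrace A = (\<Sum>i<dim_row A. A $$ (i,i))"

definition hermitian :: "complex mat \<Rightarrow> bool" where
  "hermitian A \<longleftrightarrow> A \<in> carrier_mat (dim_row A) (dim_row A) \<and> mat_adjoint A = A"

definition unitary :: "nat \<Rightarrow> complex mat \<Rightarrow> bool" where
  "unitary n U \<longleftrightarrow> U \<in> carrier_mat n n \<and> mat_adjoint U * U = 1\<^sub>m n \<and> U * mat_adjoint U = 1\<^sub>m n"

definition psd :: "nat \<Rightarrow> complex mat \<Rightarrow> bool" where
  "psd n A \<longleftrightarrow> A \<in> carrier_mat n n \<and> mat_adjoint A = A \<and>
     (\<forall>v \<in> carrier_vec n. 0 \<le> Re (conjugate v \<bullet> (A *\<^sub>v v)))"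

definition pd :: "nat \<Rightarrow> complex mat \<Rightarrow> bool" where
  "pd n A \<longleftrightarrow> A \<in> carrier_mat n n \<and> mat_adjoint A = A \<and>
     (\<forall>v \<in> carrier_vec n. v \<noteq> 0\<^sub>v n \<longrightarrow> 0 < Re (conjugate v \<bullet> (A *\<^sub>v v)))"

definition density :: "nat \<Rightarrow> complex mat \<Rightarrow> bool" where
  "density n \<rho> \<longleftrightarrow> psd n \<rho> \<and> mtrace \<rho> = 1"

(* functional calculus for Hermitian matrices via a spectral decomposition
   A = U diag(lambda) U^*; the result does not depend on the chosen decomposition *)
definition mfun :: "(real \<Rightarrow> real) \<Rightarrow> complex mat \<Rightarrow> complex mat" where
  "mfun f A = (let n = dim_row A;
                   (U, lam) = (SOME (U, lam). unitary n U \<and>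
                        A = U * mat_diag n (\<lambda>i. complex_of_real (lam i)) * mat_adjoint U)
               in U * mat_diag n (\<lambda>i. complex_of_real (f (lam i))) * mat_adjoint U)"

definition trace_norm :: "complex mat \<Rightarrow> real" where
  "trace_norm X = Re (mtrace (mfun sqrt (mat_adjoint X * X)))"

definition trace_dist :: "complex mat \<Rightarrow> complex mat \<Rightarrow> real" where
  "trace_dist \<rho> \<sigma> = trace_norm (\<rho> - \<sigma>) / 2"

definition purified_dist :: "complex mat \<Rightarrow> complex mat \<Rightarrow> real" where
  "purified_dist \<rho> \<sigma> = sqrt (1 - (trace_norm (mfun sqrt \<rho> * mfun sqrt \<sigma>))\<^sup>2)"

definition rel_entropy :: "complex mat \<Rightarrow> complex mat \<Rightarrow> real" where
  "rel_entropy \<rho> \<sigma> = Re (mtrace (\<rho> * (mfun (log 2) \<rho> - mfun (log 2) \<sigma>)))"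

definition sandwiched :: "real \<Rightarrow> complex mat \<Rightarrow> complex mat \<Rightarrow> real" where
  "sandwiched \<alpha> \<rho> \<sigma> =
     (if \<alpha> = 1 then rel_entropy \<rho> \<sigma>
      else (let S = mfun (\<lambda>x. x powr ((1 - \<alpha>) / (2 * \<alpha>))) \<sigma>
            in 1 / (\<alpha> - 1) * log 2 (Re (mtrace (mfun (\<lambda>x. x powr \<alpha>) (S * \<rho> * S))))))"

definition block :: "nat \<Rightarrow> complex mat \<Rightarrow> nat \<Rightarrow> nat \<Rightarrow> complex mat" where
  "block d X p q = mat d d (\<lambda>(a,b). X $$ (p * d + a, q * d + b))"

definition id_tensor :: "nat \<Rightarrow> nat \<Rightarrow> nat \<Rightarrow> (complex mat \<Rightarrow> complex mat) \<Rightarrow> complex mat \<Rightarrow> complex mat" where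
  "id_tensor k d1 d2 E X = mat (k * d2) (k * d2)
     (\<lambda>(i,j). E (block d1 X (i div d2) (j div d2)) $$ (i mod d2, j mod d2))"

definition channel :: "nat \<Rightarrow> nat \<Rightarrow> (complex mat \<Rightarrow> complex mat) \<Rightarrow> bool" where
  "channel d1 d2 E \<longleftrightarrow>
     (\<forall>X \<in> carrier_mat d1 d1. E X \<in> carrier_mat d2 d2) \<and>
     (\<forall>X \<in> carrier_mat d1 d1. \<forall>Y \<in> carrier_mat d1 d1. \<forall>a b::complex.
        E (a \<cdot>\<^sub>m X + b \<cdot>\<^sub>m Y) = a \<cdot>\<^sub>m E X + b \<cdot>\<^sub>m E Y) \<and>
     (\<forall>k. \<forall>X. psd (k * d1) X \<longrightarrow> psd (k * d2) (id_tensor k d1 d2 E X)) \<and>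
     (\<forall>X \<in> carrier_mat d1 d1. mtrace (E X) = mtrace X)"

definition reg_div :: "real \<Rightarrow> (nat \<Rightarrow> complex mat) \<Rightarrow> (nat \<Rightarrow> complex mat) \<Rightarrow> real" where
  "reg_div \<alpha> \<rho> \<sigma> = lim (\<lambda>n. sandwiched \<alpha> (\<rho> n) (\<sigma> n) / real n)"

end

theory Submission
  imports "HOL-Complex_Analysis.Conformal_Mappings" Defs
begin

text \<open>Let \<open>F\<close> be the fidelity of \<open>E \<rho>1\<close> and \<open>\<rho>2\<close>, and for \<open>1/2 < \<alpha> < 1\<close> let \<open>1/\<alpha> + 1/\<beta> = 2\<close> and
  \<open>\<theta> = (1 - \<alpha>)/\<alpha>\<close>. The heart of the matter is the one-shot bound
  \<open>log F\<^sup>2 \<le> \<theta> (D\<^sub>\<beta>(\<rho>1, \<sigma>1) - D\<^sub>\<alpha>(\<rho>2, \<sigma>2))\<close>. By Cauchy--Schwarz, \<open>F\<^sup>2 \<le> tr (E \<rho>1 T) tr (\<rho>2 T\<^sup>-\<^sup>1)\<close>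
  for every positive definite \<open>T\<close>; choosing \<open>T\<close> as the optimiser in the variational formula for \<open>D\<^sub>\<alpha>\<close>
  evaluates the second factor, and the first is controlled by interpolating (three lines theorem)
  between the operator norm and the trace norm, which amounts to the data processing inequality for
  \<open>D\<^sub>\<beta>\<close>. By continuity at 1, for \<open>\<alpha>\<close> close to 1 the exponent is at most \<open>-2\<gamma>n\<close> for large \<open>n\<close>, so
  \<open>F \<le> 2\<^sup>-\<^sup>\<gamma>\<^sup>n\<close>, and both distances are at least \<open>1 - F\<close> once \<open>F \<le> 1\<close>.\<close>

text \<open>The relation between \<alpha> and \<beta> gives 1 - \<theta> = 1/\<beta> and 1 +
  \<theta> = 1/\<alpha>. Hence \<rho>1 is conjugated by \<sigma>1 to the power -\<theta>/2 and
  \<rho>2 by \<sigma>2 to the power \<theta>/2, and both sides are governed by the single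
  interpolation parameter \<theta>. No divergence of E \<rho>1 is ever formed: the operator T tests
  E \<rho>1 directly, so that Hoelder duality and data processing become one inequality. Trace
  preservation controls the edge Re z = 0 of the strip, E \<sigma>1 = \<sigma>2 controls the edge Re
  z = 1, and complete positivity enters on both through 2 by 2 blocks. The obstacle is singular
  states: interpolation wants strictly positive eigenvalues, while \<rho>1 and \<rho>2 may have
  kernels. The shifts \<open>\<delta>\<close> and \<open>\<epsilon>\<close> restore positivity and
  are sent to 0 afterwards. Since \<alpha> is fixed before n and before the channels, the rate
  \<gamma> depends only on the two regularised divergences as functions of \<alpha>.\<close>

unbundle no inner_syntax and no vec_syntax

section \<open>Adjoints, traces and positivity\<close>

lemma dim_row_adjoint [simp]: "dim_row (mat_adjoint A) = dim_col A"
  and dim_col_adjoint [simp]: "dim_col (mat_adjoint A) = dim_row A"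
  by (simp_all add: mat_adjoint_def)

lemma adjoint_index [simp]:
  fixes A :: "complex mat"
  assumes "i < dim_col A" "j < dim_row A"
  shows "mat_adjoint A $$ (i,j) = cnj (A $$ (j,i))"
  using assms by (simp add: mat_adjoint_def mat_of_rows_def)

lemma adjoint_carrier [simp]: "A \<in> carrier_mat n m \<Longrightarrow> mat_adjoint A \<in> carrier_mat m n"
  by (intro carrier_matI) auto

lemma adjoint_adjoint [simp]: "mat_adjoint (mat_adjoint A) = (A :: complex mat)"
  by (rule eq_matI) auto

lemma square_mult_carrier [simp]:
  "A \<in> carrier_mat n n \<Longrightarrow> B \<in> carrier_mat n n \<Longrightarrow> A * B \<in> carrier_mat n n"
  by (rule mult_carrier_mat)

lemma adjoint_mult:
  fixes A B :: "complex mat"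
  assumes "A \<in> carrier_mat n m" "B \<in> carrier_mat m k"
  shows "mat_adjoint (A * B) = mat_adjoint B * mat_adjoint A"
  using assms by (intro eq_matI) (auto simp: scalar_prod_def mult.commute)

lemma adjoint_one [simp]: "mat_adjoint (1\<^sub>m n :: complex mat) = 1\<^sub>m n"
  by (intro eq_matI) auto

lemma adjoint_minus:
  fixes A B :: "complex mat"
  assumes "A \<in> carrier_mat n m" "B \<in> carrier_mat n m"
  shows "mat_adjoint (A - B) = mat_adjoint A - mat_adjoint B"
  using assms by (intro eq_matI) auto

lemma adjoint_mat_diag: "mat_adjoint (mat_diag n c) = mat_diag n (\<lambda>i. cnj (c i))"
  by (intro eq_matI) (auto simp: mat_diag_def)

lemma index_mult_sum:
  assumes "A \<in> carrier_mat n m" "B \<in> carrier_mat m k" "i < n" "j < k"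
  shows "(A * B) $$ (i,j) = (\<Sum>l<m. A $$ (i,l) * B $$ (l,j))"
  using assms by (auto simp: scalar_prod_def atLeast0LessThan intro!: sum.cong)

lemma mtrace_carrier: "A \<in> carrier_mat n m \<Longrightarrow> mtrace A = (\<Sum>i<n. A $$ (i,i))"
  by (auto simp: mtrace_def)

lemma mtrace_mult_sum:
  assumes "A \<in> carrier_mat n m" "B \<in> carrier_mat m n"
  shows "mtrace (A * B) = (\<Sum>i<n. \<Sum>l<m. A $$ (i,l) * B $$ (l,i))"
  using assms by (simp add: mtrace_carrier[of _ n n] index_mult_sum[OF assms] del: index_mult_mat)

lemma mtrace_comm:
  assumes "A \<in> carrier_mat n m" "B \<in> carrier_mat m n"
  shows "mtrace (A * B) = mtrace (B * A)"
  unfolding mtrace_mult_sum[OF assms] mtrace_mult_sum[OF assms(2,1)]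
  by (subst sum.swap) (simp add: mult.commute)

lemma mtrace_add:
  assumes "A \<in> carrier_mat n n" "B \<in> carrier_mat n n"
  shows "mtrace (A + B) = mtrace A + mtrace B"
  using assms by (auto simp: mtrace_def sum.distrib)

lemma mtrace_minus:
  assumes "A \<in> carrier_mat n n" "B \<in> carrier_mat n n"
  shows "mtrace (A - B) = mtrace A - mtrace B"
  using assms by (auto simp: mtrace_def sum_subtractf)

lemma mtrace_smult: "A \<in> carrier_mat n n \<Longrightarrow> mtrace (c \<cdot>\<^sub>m A) = c * mtrace A"
  by (auto simp: mtrace_def sum_distrib_left)

lemma mtrace_adjoint_mult_self:
  assumes "A \<in> carrier_mat n m"
  shows "mtrace (mat_adjoint A * A) = of_real (\<Sum>i<m. \<Sum>l<n. (cmod (A $$ (l,i)))\<^sup>2)"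
  using assms unfolding mtrace_mult_sum[OF adjoint_carrier[OF assms] assms]
  by (auto simp: complex_norm_square mult.commute simp del: of_real_power intro!: sum.cong)

lemma mtrace_mult_adjoint_self:
  assumes "A \<in> carrier_mat n m"
  shows "mtrace (A * mat_adjoint A) = of_real (\<Sum>i<n. \<Sum>l<m. (cmod (A $$ (i,l)))\<^sup>2)"
  using assms unfolding mtrace_mult_sum[OF assms adjoint_carrier[OF assms]]
  by (auto simp: complex_norm_square simp del: of_real_power intro!: sum.cong)

lemma mtrace_adjoint_mult_self_nonneg: "A \<in> carrier_mat n m \<Longrightarrow> 0 \<le> Re (mtrace (mat_adjoint A * A))"
  by (simp add: mtrace_adjoint_mult_self sum_nonneg)

lemma two_Re_mult_le: "2 * Re (x * y) \<le> (cmod x)\<^sup>2 + (cmod y)\<^sup>2"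
proof -
  have "2 * Re (x * y) \<le> 2 * (cmod x * cmod y)"
    using complex_Re_le_cmod[of "x * y"] by (simp add: norm_mult)
  also have "\<dots> \<le> (cmod x)\<^sup>2 + (cmod y)\<^sup>2"
    using sum_squares_bound[of "cmod x" "cmod y"] by simp
  finally show ?thesis .
qed

text \<open>Cauchy--Schwarz for the Hilbert--Schmidt inner product in additive form. The additive
  form survives sums and limits without square roots; the product form is recovered at the end by
  optimising over a scale, in \<open>square_le_of_scaled_sum\<close>.\<close>

lemma two_Re_mtrace_mult_le:
  assumes A: "A \<in> carrier_mat n m" and B: "B \<in> carrier_mat m n"
  shows "2 * Re (mtrace (A * B)) \<le> Re (mtrace (A * mat_adjoint A)) + Re (mtrace (mat_adjoint B * B))"
proof -
  have "2 * Re (mtrace (A * B)) = (\<Sum>i<n. \<Sum>l<m. 2 * Re (A $$ (i,l) * B $$ (l,i)))"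
    by (simp add: mtrace_mult_sum[OF A B] sum_distrib_left del: times_complex.sel)
  also have "\<dots> \<le> (\<Sum>i<n. \<Sum>l<m. (cmod (A $$ (i,l)))\<^sup>2 + (cmod (B $$ (l,i)))\<^sup>2)"
    by (intro sum_mono two_Re_mult_le)
  also have "\<dots> = Re (mtrace (A * mat_adjoint A)) + Re (mtrace (mat_adjoint B * B))"
    by (simp add: mtrace_mult_adjoint_self[OF A] mtrace_adjoint_mult_self[OF B] sum.distrib)
  finally show ?thesis .
qed

section \<open>Quadratic forms and positive semidefinite matrices\<close>

lemma quadratic_form_sum:
  assumes A: "A \<in> carrier_mat n n" and v: "v \<in> carrier_vec n"
  shows "conjugate v \<bullet> (A *\<^sub>v v) = (\<Sum>i<n. \<Sum>j<n. cnj (v $ i) * A $$ (i,j) * v $ j)"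
  using assms by (auto simp: scalar_prod_def atLeast0LessThan sum_distrib_left mult.assoc intro!: sum.cong)

lemma psd_quadratic_form:
  assumes "psd n A"
  shows "0 \<le> Re (\<Sum>i<n. \<Sum>j<n. cnj (w i) * A $$ (i,j) * w j)"
proof -
  have A: "A \<in> carrier_mat n n" using assms by (simp add: psd_def)
  have "0 \<le> Re (conjugate (vec n w) \<bullet> (A *\<^sub>v vec n w))"
    using assms by (simp add: psd_def)
  also have "conjugate (vec n w) \<bullet> (A *\<^sub>v vec n w) = (\<Sum>i<n. \<Sum>j<n. cnj (w i) * A $$ (i,j) * w j)"
    using A by (subst quadratic_form_sum) auto
  finally show ?thesis .
qed

lemma psd_mult_adjoint_self:
  assumes F: "F \<in> carrier_mat n m"
  shows "psd n (F * mat_adjoint F)"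
proof -
  have FF: "F * mat_adjoint F \<in> carrier_mat n n" using F by auto
  have "0 \<le> Re (conjugate v \<bullet> ((F * mat_adjoint F) *\<^sub>v v))" if v: "v \<in> carrier_vec n" for v
  proof -
    \<comment> \<open>\<open>y\<close> is the vector obtained by applying the adjoint of
      \<open>F\<close> to \<open>v\<close>, so the quadratic form becomes its squared norm.\<close>
    define y where "y l = (\<Sum>j<n. cnj (F $$ (j,l)) * v $ j)" for l
    have "conjugate v \<bullet> ((F * mat_adjoint F) *\<^sub>v v)
        = (\<Sum>i<n. \<Sum>j<n. \<Sum>l<m. cnj (v $ i) * F $$ (i,l) * (cnj (F $$ (j,l)) * v $ j))"
      unfolding quadratic_form_sum[OF FF v] using F
      by (auto simp: index_mult_sum[OF F adjoint_carrier[OF F]] sum_distrib_left sum_distrib_right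
          mult.assoc simp del: index_mult_mat intro!: sum.cong)
    also have "\<dots> = (\<Sum>l<m. \<Sum>i<n. \<Sum>j<n. cnj (v $ i) * F $$ (i,l) * (cnj (F $$ (j,l)) * v $ j))"
      by (simp add: sum.swap[of _ "{..<n}" "{..<m}"])
    also have "\<dots> = (\<Sum>l<m. cnj (y l) * y l)"
      unfolding y_def cnj_sum sum_product by (intro sum.cong refl) (simp add: mult_ac)
    also have "Re \<dots> \<ge> 0"
      by (simp add: sum_nonneg)
    finally show ?thesis .
  qed
  then show ?thesis
    using F FF by (auto simp: psd_def adjoint_mult[of F n m _ n])
qed

text \<open>The trace adds up the quadratic form of \<open>A\<close> over the columns of
  \<open>B\<close>.\<close>

lemma psd_mtrace_conj:
  assumes P: "psd n A" and B: "B \<in> carrier_mat n m"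
  shows "0 \<le> Re (mtrace (mat_adjoint B * A * B))"
proof -
  have A: "A \<in> carrier_mat n n" using P by (simp add: psd_def)
  have entry: "(mat_adjoint B * A) $$ (k,j) = (\<Sum>i<n. cnj (B $$ (i,k)) * A $$ (i,j))"
    if "k < m" "j < n" for k j
    using that B index_mult_sum[OF adjoint_carrier[OF B] A] by (auto intro!: sum.cong)
  have "mtrace (mat_adjoint B * A * B) = (\<Sum>k<m. \<Sum>j<n. (mat_adjoint B * A) $$ (k,j) * B $$ (j,k))"
    using A B by (intro mtrace_mult_sum) auto
  also have "\<dots> = (\<Sum>k<m. \<Sum>j<n. \<Sum>i<n. cnj (B $$ (i,k)) * A $$ (i,j) * B $$ (j,k))"
    by (simp add: entry sum_distrib_right del: index_mult_mat)
  also have "\<dots> = (\<Sum>k<m. \<Sum>i<n. \<Sum>j<n. cnj (B $$ (i,k)) * A $$ (i,j) * B $$ (j,k))"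
    by (intro sum.cong refl sum.swap)
  also have "Re \<dots> = (\<Sum>k<m. Re (\<Sum>i<n. \<Sum>j<n. cnj (B $$ (i,k)) * A $$ (i,j) * B $$ (j,k)))"
    by simp
  also have "\<dots> \<ge> 0" by (intro sum_nonneg psd_quadratic_form[OF P])
  finally show ?thesis by simp
qed

section \<open>Spectral decompositions\<close>

text \<open>All functions of one Hermitian matrix share the eigenbasis \<open>U\<close>, so
  products, sums, adjoints and traces reduce to pointwise operations on \<open>c\<close>. The values
  are complex so that imaginary powers belong to the same calculus.\<close>

definition spec :: "nat \<Rightarrow> complex mat \<Rightarrow> (nat \<Rightarrow> complex) \<Rightarrow> complex mat" where
  "spec n U c = U * mat_diag n c * mat_adjoint U"

lemma unitary_carrier: "unitary n U \<Longrightarrow> U \<in> carrier_mat n n"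
  by (simp add: unitary_def)

context
  fixes n :: nat and U :: "complex mat"
  assumes U: "unitary n U"
begin

lemma spec_carrier [simp]: "spec n U c \<in> carrier_mat n n"
  using unitary_carrier[OF U] by (auto simp: spec_def)

lemma spec_adjoint: "mat_adjoint (spec n U c) = spec n U (\<lambda>i. cnj (c i))"
  using unitary_carrier[OF U]
  by (simp add: spec_def adjoint_mult[of _ n n _ n] adjoint_mat_diag assoc_mult_mat[of _ n n _ n _ n])

lemma spec_mult: "spec n U c * spec n U d = spec n U (\<lambda>i. c i * d i)"
proof -
  have [simp]: "U \<in> carrier_mat n n" using U by (simp add: unitary_def)
  have "spec n U c * spec n U d = U * mat_diag n c * (mat_adjoint U * U) * mat_diag n d * mat_adjoint U"
    by (simp add: spec_def assoc_mult_mat[of _ n n _ n _ n])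
  also have "mat_adjoint U * U = 1\<^sub>m n" using U by (simp add: unitary_def)
  also have "U * mat_diag n c * 1\<^sub>m n * mat_diag n d * mat_adjoint U = U * (mat_diag n c * mat_diag n d) * mat_adjoint U"
    by (simp add: assoc_mult_mat[of _ n n _ n _ n] left_mult_one_mat[of _ n n] del: mat_diag_diag)
  finally show ?thesis by (simp add: spec_def)
qed

lemma spec_one: "spec n U (\<lambda>i. 1) = 1\<^sub>m n"
  using U by (auto simp: spec_def unitary_def)

lemma spec_cong: "(\<And>i. i < n \<Longrightarrow> c i = d i) \<Longrightarrow> spec n U c = spec n U d"
  by (auto simp: spec_def mat_diag_def intro!: arg_cong[of _ _ "\<lambda>x. U * x * _"])

lemma spec_mult_eq_one: "(\<And>i. i < n \<Longrightarrow> c i * d i = 1) \<Longrightarrow> spec n U c * spec n U d = 1\<^sub>m n"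
  using spec_cong[of "\<lambda>i. c i * d i" "\<lambda>i. 1"] by (simp add: spec_mult spec_one)

lemma mtrace_spec: "mtrace (spec n U c) = (\<Sum>i<n. c i)"
proof -
  have [simp]: "U \<in> carrier_mat n n" using U by (simp add: unitary_def)
  have "mtrace (spec n U c) = mtrace (mat_adjoint U * (U * mat_diag n c))"
    unfolding spec_def by (subst mtrace_comm[of _ n n]) auto
  also have "mat_adjoint U * (U * mat_diag n c) = mat_diag n c"
    using U by (simp add: unitary_def assoc_mult_mat[of _ n n _ n _ n, symmetric] left_mult_one_mat[of _ n n])
  finally show ?thesis by (simp add: mtrace_def mat_diag_def)
qed

lemma spec_index:
  assumes "i < n" "j < n"
  shows "spec n U c $$ (i,j) = (\<Sum>k<n. U $$ (i,k) * c k * cnj (U $$ (j,k)))"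
proof -
  have UC: "U \<in> carrier_mat n n" using U by (simp add: unitary_def)
  have *: "(U * mat_diag n c) $$ (i,k) = U $$ (i,k) * c k" if "k < n" for k
    using UC assms that by (simp add: mat_diag_mult_right[of _ n])
  show ?thesis
    unfolding spec_def using assms UC *
    by (subst index_mult_sum[of _ n n _ n]) (auto simp del: index_mult_mat intro!: sum.cong)
qed

lemma spec_add: "spec n U c + spec n U d = spec n U (\<lambda>i. c i + d i)"
proof (rule eq_matI)
  fix i j assume "i < dim_row (spec n U (\<lambda>i. c i + d i))" "j < dim_col (spec n U (\<lambda>i. c i + d i))"
  then have "i < n" "j < n"
    using spec_carrier[of "\<lambda>i. c i + d i"] by (simp_all del: spec_carrier)
  then show "(spec n U c + spec n U d) $$ (i,j) = spec n U (\<lambda>i. c i + d i) $$ (i,j)"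
    using spec_carrier[of c] spec_carrier[of d]
    by (simp add: spec_index sum.distrib algebra_simps del: spec_carrier)
next
  show "dim_row (spec n U c + spec n U d) = dim_row (spec n U (\<lambda>i. c i + d i))"
    using spec_carrier[of d] spec_carrier[of "\<lambda>i. c i + d i"] by (simp del: spec_carrier)
  show "dim_col (spec n U c + spec n U d) = dim_col (spec n U (\<lambda>i. c i + d i))"
    using spec_carrier[of d] spec_carrier[of "\<lambda>i. c i + d i"] by (simp del: spec_carrier)
qed

text \<open>Each eigenvalue is the quadratic form of the matrix at the corresponding column of
  \<open>U\<close>; this transfers positivity of the form to the eigenvalues.\<close>

lemma spec_eigenvalue:
  assumes "i < n"
  shows "c i = (\<Sum>k<n. \<Sum>l<n. cnj (U $$ (k,i)) * spec n U c $$ (k,l) * U $$ (l,i))"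
proof -
  have UC [simp]: "U \<in> carrier_mat n n" using U by (simp add: unitary_def)
  have [simp]: "dim_row U = n" "dim_col U = n" by (fact carrier_matD[OF UC])+
  have diag: "mat_diag n c = mat_adjoint U * spec n U c * U"
  proof -
    have "mat_adjoint U * spec n U c * U = mat_adjoint U * U * (mat_diag n c * (mat_adjoint U * U))"
      by (simp add: spec_def assoc_mult_mat[of _ n n _ n _ n])
    then show ?thesis using U by (simp add: unitary_def right_mult_one_mat[of _ n n] left_mult_one_mat[of _ n n])
  qed
  have "c i = mat_diag n c $$ (i,i)"
    using assms by (simp add: mat_diag_def)
  also have "\<dots> = (mat_adjoint U * spec n U c * U) $$ (i,i)"
    by (rule arg_cong[OF diag])
  also have "\<dots> = (\<Sum>l<n. \<Sum>k<n. cnj (U $$ (k,i)) * spec n U c $$ (k,l) * U $$ (l,i))"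
    using assms UC
    by (subst index_mult_sum[of _ n n _ n])
       (auto simp: index_mult_sum[of _ n n _ n] sum_distrib_right simp del: index_mult_mat intro!: sum.cong)
  finally show ?thesis by (subst (asm) sum.swap)
qed

lemma psd_spec_nonneg:
  assumes "psd n (spec n U (\<lambda>i. of_real (l i)))" "i < n"
  shows "0 \<le> l i"
  using psd_quadratic_form[OF assms(1), of "\<lambda>k. U $$ (k,i)"] spec_eigenvalue[OF assms(2), of "\<lambda>i. of_real (l i)"]
  by (metis Re_complex_of_real)

lemma pd_spec_pos:
  assumes P: "pd n (spec n U (\<lambda>i. of_real (l i)))" and i: "i < n"
  shows "0 < l i"
proof -
  have UC: "U \<in> carrier_mat n n" using U by (simp add: unitary_def)
  have "col U i \<noteq> 0\<^sub>v n"
  proof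
    assume z: "col U i = 0\<^sub>v n"
    have "(mat_adjoint U * U) $$ (i,i) = 0"
      using i UC z by simp
    then show False using U i by (simp add: unitary_def)
  qed
  moreover have "col U i \<in> carrier_vec n" using UC i by simp
  ultimately have "0 < Re (conjugate (col U i) \<bullet> (spec n U (\<lambda>i. of_real (l i)) *\<^sub>v col U i))"
    using P by (simp add: pd_def)
  also have "conjugate (col U i) \<bullet> (spec n U (\<lambda>i. of_real (l i)) *\<^sub>v col U i) = of_real (l i)"
    using UC i by (subst quadratic_form_sum[of _ n]) (auto simp: spec_eigenvalue[OF i, of "\<lambda>i. of_real (l i)"])
  finally show ?thesis by simp
qed

end

section \<open>Diagonalisation of Hermitian matrices\<close>

lemma unitary_mult:
  assumes U: "unitary n U" and V: "unitary n V"
  shows "unitary n (U * V)"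
proof -
  have [simp]: "U \<in> carrier_mat n n" "V \<in> carrier_mat n n" using U V by (simp_all add: unitary_def)
  have "mat_adjoint (U * V) * (U * V) = mat_adjoint V * ((mat_adjoint U * U) * V)"
    by (simp add: adjoint_mult[of _ n n _ n] assoc_mult_mat[of _ n n _ n _ n])
  moreover have "(U * V) * mat_adjoint (U * V) = U * ((V * mat_adjoint V) * mat_adjoint U)"
    by (simp add: adjoint_mult[of _ n n _ n] assoc_mult_mat[of _ n n _ n _ n])
  ultimately show ?thesis
    using U V by (simp add: unitary_def left_mult_one_mat[of _ n n])
qed

lemma unitary_adjoint: "unitary n U \<Longrightarrow> unitary n (mat_adjoint U)"
  by (simp add: unitary_def)

text \<open>A one-sided inverse of a square matrix is two-sided, so orthonormality of the columns
  decides unitarity.\<close>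

lemma unitary_iff_index:
  assumes U: "U \<in> carrier_mat n n"
  shows "unitary n U \<longleftrightarrow> (\<forall>i<n. \<forall>j<n. (\<Sum>k<n. cnj (U $$ (k,i)) * U $$ (k,j)) = (if i = j then 1 else 0))"
    (is "_ \<longleftrightarrow> ?orth")
proof -
  have idx: "(mat_adjoint U * U) $$ (i,j) = (\<Sum>k<n. cnj (U $$ (k,i)) * U $$ (k,j))" if "i < n" "j < n" for i j
    using that U index_mult_sum[OF adjoint_carrier[OF U] U that] by (auto intro!: sum.cong)
  have "mat_adjoint U * U = 1\<^sub>m n \<longleftrightarrow> ?orth"
  proof
    assume "mat_adjoint U * U = 1\<^sub>m n"
    then show ?orth using idx by (metis index_one_mat(1))
  next
    assume ?orth
    then show "mat_adjoint U * U = 1\<^sub>m n"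
      using U by (intro eq_matI) (auto simp: idx simp del: index_mult_mat(1))
  qed
  moreover have "U * mat_adjoint U = 1\<^sub>m n" if "mat_adjoint U * U = 1\<^sub>m n"
    using mat_mult_left_right_inverse[OF adjoint_carrier[OF U] U that] .
  ultimately show ?thesis using U by (auto simp: unitary_def)
qed

text \<open>Complete \<open>v\<close> to a basis and orthogonalise. Gram--Schmidt keeps the head
  \<open>v\<close> but yields vectors that are only orthogonal; the factors \<open>r\<close>
  normalise them, whence the scalar \<open>c\<close>.\<close>

lemma exists_unitary_col_0:
  fixes v :: "complex vec"
  assumes v: "v \<in> carrier_vec n" "v \<noteq> 0\<^sub>v n"
  shows "\<exists>W c. unitary n W \<and> col W 0 = c \<cdot>\<^sub>v v"
proof -
  interpret cof_vec_space n "TYPE(complex)" .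
  define b where "b = basis_completion v"
  define ws where "ws = gram_schmidt n b"
  from basis_completion[OF v, folded b_def]
  have dist_b: "distinct b" and indep: "\<not> lin_dep (set b)" and b: "set b \<subseteq> carrier_vec n"
    and hdb: "hd b = v" and len_b: "length b = n" by auto
  have n: "n \<noteq> 0" using v by auto
  then obtain vs where bv: "b = v # vs" using hdb len_b by (cases b) auto
  from gram_schmidt_result[OF b dist_b indep refl, folded ws_def]
  have ws: "set ws \<subseteq> carrier_vec n" "corthogonal ws" "length ws = n" by (auto simp: len_b)
  have hdws: "hd ws = v" using gram_schmidt_hd[OF v(1), of vs, folded bv] unfolding ws_def .
  define r where "r i = complex_of_real (1 / sqrt (Re (ws ! i \<bullet>c ws ! i)))" for i
  define W where "W = mat n n (\<lambda>(i,j). r j * ws ! j $ i)"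
  have W: "W \<in> carrier_mat n n" by (simp add: W_def)
  have wsc: "ws ! i \<in> carrier_vec n" if "i < n" for i using ws that by auto
  have ip: "ws ! i \<bullet>c ws ! j = (\<Sum>k<n. ws ! i $ k * cnj (ws ! j $ k))" if "i < n" "j < n" for i j
    using wsc[OF that(1)] wsc[OF that(2)] by (auto simp: scalar_prod_def atLeast0LessThan)
  have cnj_r: "cnj (r i) = r i" for i by (simp add: r_def)
  have norm1: "r i * r i * (ws ! i \<bullet>c ws ! i) = 1" if i: "i < n" for i
  proof -
    define t where "t = (\<Sum>k<n. (cmod (ws ! i $ k))\<^sup>2)"
    have t: "ws ! i \<bullet>c ws ! i = of_real t"
      unfolding ip[OF i i] t_def by (simp add: complex_norm_square del: of_real_power)
    moreover have "ws ! i \<bullet>c ws ! i \<noteq> 0"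
      using corthogonalD[OF ws(2), of i i] i ws(3) by simp
    ultimately have "t \<noteq> 0" by auto
    moreover have "t \<ge> 0" unfolding t_def by (intro sum_nonneg) auto
    ultimately have "t > 0" by simp
    have "r i * r i * (ws ! i \<bullet>c ws ! i) = of_real (1 / sqrt t * (1 / sqrt t) * t)"
      unfolding r_def t by (simp only: of_real_mult Re_complex_of_real)
    also have "1 / sqrt t * (1 / sqrt t) * t = 1" using \<open>t > 0\<close> by simp
    finally show ?thesis by simp
  qed
  have "unitary n W"
    unfolding unitary_iff_index[OF W]
  proof (intro allI impI)
    fix i j assume ij: "i < n" "j < n"
    have "(\<Sum>k<n. cnj (W $$ (k,i)) * W $$ (k,j)) = r i * r j * (ws ! j \<bullet>c ws ! i)"
      using ij by (simp add: W_def ip sum_distrib_left cnj_r mult_ac)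
    also have "\<dots> = (if i = j then 1 else 0)"
      using norm1[OF ij(1)] corthogonalD[OF ws(2), of j i] ij ws(3) by auto
    finally show "(\<Sum>k<n. cnj (W $$ (k,i)) * W $$ (k,j)) = (if i = j then 1 else 0)" .
  qed
  moreover have "col W 0 = r 0 \<cdot>\<^sub>v v"
  proof -
    have "ws ! 0 = v" using hdws ws(3) n by (cases ws) auto
    then show ?thesis using n v by (intro eq_vecI) (auto simp: W_def)
  qed
  ultimately show ?thesis by blast
qed

text \<open>Deflation: in a unitary basis that starts with an eigenvector the first column is a
  multiple of the first unit vector, and Hermiticity clears the first row and makes the eigenvalue
  real. The induction hypothesis diagonalises the remaining block.\<close>

lemma hermitian_spectral_decomposition:
  "A \<in> carrier_mat n n \<Longrightarrow> mat_adjoint A = A \<Longrightarrow> \<exists>U l. unitary n U \<and> A = spec n U (\<lambda>i. of_real (l i))"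
proof (induction n arbitrary: A)
  case 0
  have "unitary 0 (1\<^sub>m 0)" by (simp add: unitary_def)
  moreover have "A = spec 0 (1\<^sub>m 0) (\<lambda>i. of_real 0)"
    using 0 by (intro eq_matI) (auto simp: spec_def)
  ultimately show ?case by (intro exI[of _ "1\<^sub>m 0"] exI[of _ "\<lambda>_. 0"] conjI)
next
  case (Suc m)
  let ?n = "Suc m"
  note A = Suc.prems(1)
  have "\<not> constant (poly (char_poly A))"
    using degree_monic_char_poly[OF A] by (simp add: constant_degree)
  then obtain e where "poly (char_poly A) e = 0"
    using fundamental_theorem_of_algebra by blast
  then have "eigenvalue A e" using eigenvalue_root_char_poly[OF A] by simp
  then obtain v where v: "v \<in> carrier_vec ?n" "v \<noteq> 0\<^sub>v ?n" "A *\<^sub>v v = e \<cdot>\<^sub>v v"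
    using A by (auto simp: eigenvalue_def eigenvector_def)
  obtain W c where W: "unitary ?n W" and W0: "col W 0 = c \<cdot>\<^sub>v v"
    using exists_unitary_col_0[OF v(1,2)] by blast
  have WC: "W \<in> carrier_mat ?n ?n" using W by (simp add: unitary_def)
  define A' where "A' = mat_adjoint W * (A * W)"
  have A': "A' \<in> carrier_mat ?n ?n" using A WC by (simp add: A'_def)
  have dimA' [simp]: "dim_row A' = ?n" "dim_col A' = ?n" by (fact carrier_matD[OF A'])+
  have "col (A * W) 0 = e \<cdot>\<^sub>v col W 0"
  proof -
    have "col (A * W) 0 = A *\<^sub>v col W 0" using A WC by (intro col_mult2) auto
    also have "\<dots> = c \<cdot>\<^sub>v (A *\<^sub>v v)" using A v W0 by (simp add: mult_mat_vec[of _ ?n ?n])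
    finally show ?thesis using v W0 by (simp add: smult_smult_assoc mult.commute)
  qed
  note colAW = this
  have AW0: "(A * W) $$ (l,0) = e * W $$ (l,0)" if "l < ?n" for l
  proof -
    have "(A * W) $$ (l,0) = col (A * W) 0 $ l" using that A WC by simp
    also have "\<dots> = e * W $$ (l,0)" unfolding colAW using that WC by simp
    finally show ?thesis .
  qed
  have A'0: "A' $$ (i,0) = (if i = 0 then e else 0)" if "i < ?n" for i
  proof -
    have "A' $$ (i,0) = (\<Sum>l<?n. mat_adjoint W $$ (i,l) * (A * W) $$ (l,0))"
      unfolding A'_def using A WC that by (intro index_mult_sum) auto
    also have "\<dots> = e * (\<Sum>l<?n. mat_adjoint W $$ (i,l) * W $$ (l,0))"
      unfolding sum_distrib_left by (intro sum.cong refl) (simp add: AW0 mult_ac del: index_mult_mat)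
    also have "(\<Sum>l<?n. mat_adjoint W $$ (i,l) * W $$ (l,0)) = (mat_adjoint W * W) $$ (i,0)"
      using WC that by (intro index_mult_sum[symmetric]) auto
    finally show ?thesis using W that by (simp add: unitary_def)
  qed
  have A'h: "mat_adjoint A' = A'"
    using A WC Suc.prems(2) unfolding A'_def
    by (simp add: adjoint_mult[of _ ?n ?n _ ?n] assoc_mult_mat[of _ ?n ?n _ ?n _ ?n])
  have sym: "A' $$ (i,j) = cnj (A' $$ (j,i))" if "i < ?n" "j < ?n" for i j
    using adjoint_index[of i A' j] that by (simp add: A'h)
  have e_real: "e = of_real (Re e)"
    using sym[of 0 0] A'0[of 0] by (simp add: complex_eq_iff)
  define A3 where "A3 = mat m m (\<lambda>(i,j). A' $$ (Suc i, Suc j))"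
  have A3: "A3 \<in> carrier_mat m m" by (simp add: A3_def)
  moreover have "mat_adjoint A3 = A3"
    by (intro eq_matI) (auto simp: A3_def intro: sym[symmetric])
  ultimately obtain U3 l3 where U3: "unitary m U3" and A3s: "A3 = spec m U3 (\<lambda>i. of_real (l3 i))"
    using Suc.IH by blast
  have U3C: "U3 \<in> carrier_mat m m" using U3 by (simp add: unitary_def)
  \<comment> \<open>\<open>U'\<close> is the direct sum of the 1 by 1 identity and
    \<open>U3\<close>.\<close>
  define U' where "U' = mat ?n ?n (\<lambda>(i,j). case (i,j) of (0,0) \<Rightarrow> 1 | (Suc i, Suc j) \<Rightarrow> U3 $$ (i,j) | _ \<Rightarrow> 0)"
  define l where "l i = (case i of 0 \<Rightarrow> Re e | Suc i \<Rightarrow> l3 i)" for i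
  have U'C: "U' \<in> carrier_mat ?n ?n" by (simp add: U'_def)
  have orth3: "(\<Sum>k<m. cnj (U3 $$ (k,i)) * U3 $$ (k,j)) = (if i = j then 1 else 0)" if "i < m" "j < m" for i j
    using U3[unfolded unitary_iff_index[OF U3C]] that by blast
  have U': "unitary ?n U'"
    unfolding unitary_iff_index[OF U'C]
    by (auto simp: U'_def orth3 less_Suc_eq_0_disj sum.lessThan_Suc_shift simp del: sum.lessThan_Suc split: if_splits)
  have A's: "A' = spec ?n U' (\<lambda>i. of_real (l i))"
  proof (rule eq_matI)
    fix i j assume "i < dim_row (spec ?n U' (\<lambda>i. of_real (l i)))" "j < dim_col (spec ?n U' (\<lambda>i. of_real (l i)))"
    then have ij: "i < ?n" "j < ?n" using carrier_matD[OF spec_carrier[OF U']] by auto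
    show "A' $$ (i,j) = spec ?n U' (\<lambda>i. of_real (l i)) $$ (i,j)"
    proof (cases "i = 0 \<or> j = 0")
      case True
      then have "A' $$ (i,j) = (if i = j then e else 0)"
        using A'0[OF ij(1)] A'0[OF ij(2)] sym[OF ij] e_real by (auto split: if_splits)
      then show ?thesis
        unfolding spec_index[OF U' ij] using True ij e_real
        by (auto simp: U'_def l_def less_Suc_eq_0_disj sum.lessThan_Suc_shift simp del: sum.lessThan_Suc)
    next
      case False
      then obtain i' j' where i'j': "i = Suc i'" "j = Suc j'" "i' < m" "j' < m"
        using ij by (metis less_Suc_eq_0_disj)
      have "A' $$ (i,j) = A3 $$ (i',j')" using i'j' by (simp add: A3_def)
      also have "\<dots> = (\<Sum>k<m. U3 $$ (i',k) * of_real (l3 k) * cnj (U3 $$ (j',k)))"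
        unfolding A3s using i'j' by (simp add: spec_index[OF U3])
      also have "\<dots> = spec ?n U' (\<lambda>i. of_real (l i)) $$ (i,j)"
        unfolding spec_index[OF U' ij] using i'j'
        by (auto simp: U'_def l_def sum.lessThan_Suc_shift simp del: sum.lessThan_Suc)
      finally show ?thesis .
    qed
  qed (use carrier_matD[OF spec_carrier[OF U']] in auto)
  have "A = W * A' * mat_adjoint W"
  proof -
    have "W * A' * mat_adjoint W = (W * mat_adjoint W) * (A * (W * mat_adjoint W))"
      using A WC by (simp add: A'_def assoc_mult_mat[of _ ?n ?n _ ?n _ ?n])
    then show ?thesis using W A by (simp add: unitary_def left_mult_one_mat[of _ ?n ?n] right_mult_one_mat[of _ ?n ?n])
  qed
  also have "\<dots> = spec ?n (W * U') (\<lambda>i. of_real (l i))"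
    using WC U'C unfolding A's spec_def
    by (simp add: adjoint_mult[of _ ?n ?n _ ?n] assoc_mult_mat[of _ ?n ?n _ ?n _ ?n])
  finally show ?case using unitary_mult[OF W U'] by blast
qed

text \<open>The pair picked by the choice operator in \<open>mfun\<close> depends on
  \<open>A\<close> alone and not on the function, so one decomposition serves all \<open>f\<close>
  at once. Identities between several functions of \<open>A\<close> then hold in a common
  eigenbasis.\<close>

lemma mfun_spectral:
  assumes A: "A \<in> carrier_mat n n" "mat_adjoint A = A"
  obtains U l where "unitary n U" "A = spec n U (\<lambda>i. of_real (l i))"
    "\<And>f. mfun f A = spec n U (\<lambda>i. of_real (f (l i)))"
proof -
  let ?P = "\<lambda>(U, l). unitary n U \<and> A = U * mat_diag n (\<lambda>i. complex_of_real (l i)) * mat_adjoint U"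
  obtain U l where Ul: "(SOME p. ?P p) = (U, l)" by (cases "SOME p. ?P p")
  have "\<exists>p. ?P p"
    using hermitian_spectral_decomposition[OF A] by (auto simp: spec_def)
  then have P: "?P (U, l)" unfolding Ul[symmetric] by (rule someI_ex)
  have dim: "dim_row A = n" using A(1) by simp
  show thesis
  proof
    show "unitary n U" "A = spec n U (\<lambda>i. of_real (l i))" using P by (simp_all add: spec_def)
    show "mfun f A = spec n U (\<lambda>i. of_real (f (l i)))" for f
      unfolding mfun_def Let_def dim Ul by (simp add: spec_def)
  qed
qed

section \<open>The three lines theorem\<close>

text \<open>The functions needed here are finite sums of products of exponentials, hence entire;
  boundedness on the closed strip is the growth condition without which the three lines theorem
  fails.\<close>

definition strip_holomorphic :: "(complex \<Rightarrow> complex) \<Rightarrow> bool" where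
  "strip_holomorphic f \<longleftrightarrow> f holomorphic_on UNIV \<and> (\<exists>K. \<forall>z. 0 \<le> Re z \<and> Re z \<le> 1 \<longrightarrow> cmod (f z) \<le> K)"

lemma strip_holomorphic_const: "strip_holomorphic (\<lambda>z. c)"
  unfolding strip_holomorphic_def by (auto intro!: exI[of _ "cmod c"])

lemma strip_holomorphic_exp: "strip_holomorphic (\<lambda>z. exp (of_real u + of_real v * z))"
  unfolding strip_holomorphic_def
proof (intro conjI exI[of _ "exp (\<bar>u\<bar> + \<bar>v\<bar>)"] allI impI)
  show "(\<lambda>z. exp (of_real u + of_real v * z)) holomorphic_on UNIV"
    by (intro holomorphic_intros)
next
  fix z assume z: "0 \<le> Re z \<and> Re z \<le> 1"
  have "v * Re z \<le> \<bar>v\<bar> * 1"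
    using z by (intro mult_mono) auto
  then show "cmod (exp (of_real u + of_real v * z)) \<le> exp (\<bar>u\<bar> + \<bar>v\<bar>)" by simp
qed

lemma strip_holomorphic_add:
  assumes "strip_holomorphic f" "strip_holomorphic g"
  shows "strip_holomorphic (\<lambda>z. f z + g z)"
proof -
  obtain K L where K: "\<And>z. 0 \<le> Re z \<and> Re z \<le> 1 \<Longrightarrow> cmod (f z) \<le> K"
    and L: "\<And>z. 0 \<le> Re z \<and> Re z \<le> 1 \<Longrightarrow> cmod (g z) \<le> L"
    using assms unfolding strip_holomorphic_def by blast
  have "cmod (f z + g z) \<le> K + L" if "0 \<le> Re z \<and> Re z \<le> 1" for z
    using norm_triangle_ineq[of "f z" "g z"] K[OF that] L[OF that] by linarith
  then show ?thesis
    using assms unfolding strip_holomorphic_def by (auto intro!: holomorphic_intros)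
qed

lemma strip_holomorphic_mult:
  assumes "strip_holomorphic f" "strip_holomorphic g"
  shows "strip_holomorphic (\<lambda>z. f z * g z)"
proof -
  obtain K L where K: "\<And>z. 0 \<le> Re z \<and> Re z \<le> 1 \<Longrightarrow> cmod (f z) \<le> K"
    and L: "\<And>z. 0 \<le> Re z \<and> Re z \<le> 1 \<Longrightarrow> cmod (g z) \<le> L"
    using assms unfolding strip_holomorphic_def by blast
  have "cmod (f z * g z) \<le> K * L" if "0 \<le> Re z \<and> Re z \<le> 1" for z
  proof -
    have "0 \<le> K" using K[OF that] norm_ge_zero order_trans by blast
    then show ?thesis
      unfolding norm_mult using K[OF that] L[OF that] by (intro mult_mono) auto
  qed
  then show ?thesis
    using assms unfolding strip_holomorphic_def by (auto intro!: holomorphic_intros)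
qed

lemma strip_holomorphic_sum:
  "(\<And>i. i \<in> I \<Longrightarrow> strip_holomorphic (f i)) \<Longrightarrow> strip_holomorphic (\<lambda>z. \<Sum>i\<in>I. f i z)"
  by (induction I rule: infinite_finite_induct) (auto intro: strip_holomorphic_const strip_holomorphic_add)

text \<open>The maximum modulus principle wants a bounded region. A Gaussian factor that is at most
  1 in modulus on the strip makes the function small far away, so a large rectangle can replace the
  strip; letting \<open>\<epsilon>\<close> tend to 0 removes the factor.\<close>

lemma strip_holomorphic_le_one:
  assumes f: "strip_holomorphic f"
    and f0: "\<And>t. cmod (f (Complex 0 t)) \<le> 1" and f1: "\<And>t. cmod (f (Complex 1 t)) \<le> 1"
    and x: "0 < x" "x < 1"
  shows "cmod (f (of_real x)) \<le> 1"
proof -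
  obtain K where K: "\<And>z. 0 \<le> Re z \<and> Re z \<le> 1 \<Longrightarrow> cmod (f z) \<le> K"
    using f unfolding strip_holomorphic_def by blast
  have bound: "cmod (f (of_real x)) \<le> exp (\<epsilon> * (1 - x\<^sup>2))" if \<epsilon>: "\<epsilon> > 0" for \<epsilon>
  proof -
    \<comment> \<open>The real part of z^2 - 1 is at most -(Im z)^2 on the strip, which gives both
      the bound by 1 and the decay.\<close>
    define g where "g z = f z * exp (of_real \<epsilon> * (z\<^sup>2 - 1))" for z
    have norm_g: "cmod (g z) = cmod (f z) * exp (\<epsilon> * ((Re z)\<^sup>2 - (Im z)\<^sup>2 - 1))" for z
      by (simp add: g_def norm_mult power2_eq_square)
    \<comment> \<open>On the horizontal sides only the crude bound \<open>K\<close> is known for f;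
      \<open>R\<close> is so large that the decay beats it.\<close>
    have "eventually (\<lambda>R. K * exp (- \<epsilon> * R\<^sup>2) < 1) at_top"
      using \<epsilon> by real_asymp
    then obtain R where R: "R > 0" "K * exp (- \<epsilon> * R\<^sup>2) < 1"
      using eventually_conj[OF eventually_gt_at_top[of 0]] eventually_happens[of _ "at_top::real filter"] by (metis (mono_tags, lifting) trivial_limit_at_top_linorder)
    define S where "S = cbox (Complex 0 (-R)) (Complex 1 R)"
    have S_iff: "z \<in> S \<longleftrightarrow> 0 \<le> Re z \<and> Re z \<le> 1 \<and> -R \<le> Im z \<and> Im z \<le> R" for z
      by (auto simp: S_def in_cbox_complex_iff)
    have intS: "interior S = {z. 0 < Re z \<and> Re z < 1 \<and> -R < Im z \<and> Im z < R}"
      by (auto simp: S_def interior_cbox in_box_complex_iff)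
    have holo: "g holomorphic_on UNIV"
      using f unfolding g_def strip_holomorphic_def by (auto intro!: holomorphic_intros)
    have "cmod (g (of_real x)) \<le> 1"
    proof (rule maximum_modulus_frontier[where S = S and f = g])
      show "g holomorphic_on interior S" using holo by (rule holomorphic_on_subset) simp
      show "continuous_on (closure S) g"
        using holo holomorphic_on_imp_continuous_on continuous_on_subset by blast
      show "bounded S" by (simp add: S_def)
      show "of_real x \<in> S" using x R by (simp add: S_iff)
    next
      fix z assume z: "z \<in> frontier S"
      then have zS: "z \<in> S" and "z \<notin> interior S"
        by (auto simp: frontier_def S_def)
      then have "Re z = 0 \<or> Re z = 1 \<or> (Im z)\<^sup>2 = R\<^sup>2"
        by (auto simp: S_iff intS power2_eq_iff)
      moreover have "cmod (g z) \<le> 1" if "Re z = 0"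
      proof -
        have "cmod (f z) \<le> 1" using f0[of "Im z"] that by (metis complex.collapse)
        moreover have "exp (\<epsilon> * ((Re z)\<^sup>2 - (Im z)\<^sup>2 - 1)) \<le> 1"
          using \<epsilon> that order_trans[OF _ zero_le_power2[of "Im z"], of "-1"] by (simp add: mult_le_0_iff)
        ultimately show ?thesis unfolding norm_g by (intro mult_le_one) auto
      qed
      moreover have "cmod (g z) \<le> 1" if "Re z = 1"
      proof -
        have "cmod (f z) \<le> 1" using f1[of "Im z"] that by (metis complex.collapse)
        moreover have "exp (\<epsilon> * ((Re z)\<^sup>2 - (Im z)\<^sup>2 - 1)) \<le> 1"
          using \<epsilon> that order_trans[OF _ zero_le_power2[of "Im z"], of "-1"] by (simp add: mult_le_0_iff)
        ultimately show ?thesis unfolding norm_g by (intro mult_le_one) auto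
      qed
      moreover have "cmod (g z) \<le> 1" if "(Im z)\<^sup>2 = R\<^sup>2"
      proof -
        have z01: "0 \<le> Re z \<and> Re z \<le> 1" using zS by (simp add: S_iff)
        have "(Re z)\<^sup>2 \<le> 1" using z01 by (simp add: abs_square_le_1)
        then have "\<epsilon> * ((Re z)\<^sup>2 - (Im z)\<^sup>2 - 1) \<le> - \<epsilon> * R\<^sup>2"
          using \<epsilon> that mult_left_mono[of "(Re z)\<^sup>2 - R\<^sup>2 - 1" "- (R\<^sup>2)" \<epsilon>] by simp
        moreover have "0 \<le> K" using K[OF z01] norm_ge_zero order_trans by blast
        ultimately have "cmod (g z) \<le> K * exp (- \<epsilon> * R\<^sup>2)"
          unfolding norm_g using K[OF z01] by (intro mult_mono) auto
        then show ?thesis using R by simp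
      qed
      ultimately show "cmod (g z) \<le> 1" by blast
    qed
    then have "cmod (f (of_real x)) * exp (- (\<epsilon> * (1 - x\<^sup>2))) \<le> 1"
      by (simp add: norm_g algebra_simps)
    then show ?thesis unfolding exp_minus by (simp add: divide_simps)
  qed
  have "((\<lambda>\<epsilon>. exp (\<epsilon> * (1 - x\<^sup>2))) \<longlongrightarrow> exp (0 * (1 - x\<^sup>2))) (at_right 0)"
    by (intro tendsto_intros)
  then have "cmod (f (of_real x)) \<le> exp (0 * (1 - x\<^sup>2))"
    by (rule tendsto_lowerbound)
       (auto simp: eventually_at_right_field intro!: exI[of _ 1] bound)
  then show ?thesis by simp
qed

text \<open>Dividing by the nowhere vanishing function M0^(1-z) M1^z turns both edge bounds into
  1.\<close>

lemma three_lines: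
  assumes f: "strip_holomorphic f" and M: "0 < M0" "0 < M1"
    and f0: "\<And>t. cmod (f (Complex 0 t)) \<le> M0" and f1: "\<And>t. cmod (f (Complex 1 t)) \<le> M1"
    and x: "0 < x" "x < 1"
  shows "cmod (f (of_real x)) \<le> M0 powr (1 - x) * M1 powr x"
proof -
  define g where "g z = f z * exp (of_real (- ln M0) + of_real (ln M0 - ln M1) * z)" for z
  have norm_g: "cmod (g z) = cmod (f z) * (M0 powr (Re z - 1) * M1 powr (- Re z))" for z
    using M by (simp add: g_def norm_mult powr_def exp_add[symmetric] algebra_simps)
  have "strip_holomorphic g"
    unfolding g_def by (intro strip_holomorphic_mult f strip_holomorphic_exp)
  moreover have "cmod (g (Complex 0 t)) \<le> 1" for t
    using f0[of t] M by (simp add: norm_g powr_minus_divide)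
  moreover have "cmod (g (Complex 1 t)) \<le> 1" for t
    using f1[of t] M by (simp add: norm_g powr_minus_divide)
  ultimately have "cmod (g (of_real x)) \<le> 1"
    using x by (rule strip_holomorphic_le_one)
  then have "cmod (f (of_real x)) / (M0 powr (1 - x) * M1 powr x) \<le> 1"
    using powr_minus_divide[of M0 "1 - x"] by (simp add: norm_g powr_minus_divide[of M1 x])
  moreover have "0 < M0 powr (1 - x) * M1 powr x" using M by simp
  ultimately show ?thesis by (metis divide_le_eq_1_pos)
qed

section \<open>Interpolation for channels\<close>

lemma sum_lessThan_add: "(\<Sum>i<m + n. f i) = (\<Sum>i<m. f i) + (\<Sum>i<n. f (m + i))"
  for f :: "nat \<Rightarrow> 'a::comm_monoid_add"
  by (induction n) (simp_all add: add.assoc)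

lemma mtrace_mult3:
  assumes A: "A \<in> carrier_mat m n" and P: "P \<in> carrier_mat n n" and B: "B \<in> carrier_mat n m"
  shows "mtrace (A * P * B) = (\<Sum>k<m. \<Sum>i<n. \<Sum>j<n. A $$ (k,i) * P $$ (i,j) * B $$ (j,k))"
proof -
  have "mtrace (A * P * B) = (\<Sum>k<m. \<Sum>j<n. (A * P) $$ (k,j) * B $$ (j,k))"
    using A P B by (intro mtrace_mult_sum) auto
  also have "\<dots> = (\<Sum>k<m. \<Sum>j<n. \<Sum>i<n. A $$ (k,i) * P $$ (i,j) * B $$ (j,k))"
    by (simp add: index_mult_sum[OF A P] sum_distrib_right del: index_mult_mat)
  also have "\<dots> = (\<Sum>k<m. \<Sum>i<n. \<Sum>j<n. A $$ (k,i) * P $$ (i,j) * B $$ (j,k))"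
    by (intro sum.cong refl sum.swap)
  finally show ?thesis .
qed

lemma channel_carrier: "channel d1 d2 E \<Longrightarrow> X \<in> carrier_mat d1 d1 \<Longrightarrow> E X \<in> carrier_mat d2 d2"
  by (simp add: channel_def)

lemma channel_mtrace: "channel d1 d2 E \<Longrightarrow> X \<in> carrier_mat d1 d1 \<Longrightarrow> mtrace (E X) = mtrace X"
  by (simp add: channel_def)

lemma channel_linear:
  "channel d1 d2 E \<Longrightarrow> X \<in> carrier_mat d1 d1 \<Longrightarrow> Y \<in> carrier_mat d1 d1 \<Longrightarrow>
    E (a \<cdot>\<^sub>m X + b \<cdot>\<^sub>m Y) = a \<cdot>\<^sub>m E X + b \<cdot>\<^sub>m E Y"
  by (simp add: channel_def)

text \<open>Stack \<open>F\<close> on top of the adjoint of \<open>G\<close> to get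
  \<open>C\<close>. The matrix \<open>C\<close> times its adjoint is positive with blocks made of
  the three products in the statement, and complete positivity at k = 2 keeps the block matrix of
  images positive. The inequality is its quadratic form at the vector (x, y).\<close>

lemma channel_quadratic_form:
  assumes E: "channel d1 d2 E" and F: "F \<in> carrier_mat d1 d1" and G: "G \<in> carrier_mat d1 d1"
  shows "0 \<le> Re (\<Sum>i<d2. \<Sum>j<d2. cnj (x i) * E (F * mat_adjoint F) $$ (i,j) * x j)
      + 2 * Re (\<Sum>i<d2. \<Sum>j<d2. cnj (x i) * E (F * G) $$ (i,j) * y j)
      + Re (\<Sum>i<d2. \<Sum>j<d2. cnj (y i) * E (mat_adjoint G * G) $$ (i,j) * y j)"
proof -
  define C where "C = mat (2 * d1) d1 (\<lambda>(a,k). if a < d1 then F $$ (a,k) else cnj (G $$ (k, a - d1)))"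
  define X where "X = C * mat_adjoint C"
  have C: "C \<in> carrier_mat (2 * d1) d1" by (simp add: C_def)
  have dim [simp]: "dim_row F = d1" "dim_col F = d1" "dim_row G = d1" "dim_col G = d1"
    "dim_row C = 2 * d1" "dim_col C = d1"
    using F G C by auto
  have X: "X $$ (a,b) = (\<Sum>k<d1. C $$ (a,k) * cnj (C $$ (b,k)))" if "a < 2 * d1" "b < 2 * d1" for a b
    unfolding X_def using that index_mult_sum[OF C adjoint_carrier[OF C] that] by simp
  have b00: "block d1 X 0 0 = F * mat_adjoint F"
    by (intro eq_matI)
       (auto simp: block_def X C_def index_mult_sum[OF F adjoint_carrier[OF F]] simp del: index_mult_mat(1))
  have b01: "block d1 X 0 1 = F * G"
    by (intro eq_matI)
       (auto simp: block_def X C_def index_mult_sum[OF F G] simp del: index_mult_mat(1))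
  have b11: "block d1 X 1 1 = mat_adjoint G * G"
    by (intro eq_matI)
       (auto simp: block_def X C_def index_mult_sum[OF adjoint_carrier[OF G] G] simp del: index_mult_mat(1))
  define M where "M = id_tensor 2 d1 d2 E X"
  have "psd (2 * d1) X" unfolding X_def by (rule psd_mult_adjoint_self[OF C])
  then have M: "psd (2 * d2) M" using E by (auto simp: channel_def M_def)
  then have MC: "M \<in> carrier_mat (2 * d2) (2 * d2)" and Mh: "mat_adjoint M = M" by (auto simp: psd_def)
  have M00: "M $$ (i,j) = E (F * mat_adjoint F) $$ (i,j)" if "i < d2" "j < d2" for i j
    using that b00 by (simp add: M_def id_tensor_def)
  have M01: "M $$ (i,d2 + j) = E (F * G) $$ (i,j)" if "i < d2" "j < d2" for i j
    using that b01 by (simp add: M_def id_tensor_def)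
  have M11: "M $$ (d2 + i,d2 + j) = E (mat_adjoint G * G) $$ (i,j)" if "i < d2" "j < d2" for i j
    using that b11 by (simp add: M_def id_tensor_def)
  \<comment> \<open>The lower left block is read off from Hermiticity of the image, which avoids
    relating \<open>E\<close> to adjoints.\<close>
  have M10: "M $$ (d2 + i,j) = cnj (E (F * G) $$ (j,i))" if "i < d2" "j < d2" for i j
    using adjoint_index[of "d2 + i" M j] that MC M01[OF that(2,1)] by (simp add: Mh)
  define w where "w i = (if i < d2 then x i else y (i - d2))" for i
  define S where "S = (\<Sum>i<d2. \<Sum>j<d2. cnj (x i) * E (F * G) $$ (i,j) * y j)"
  have cross: "(\<Sum>i<d2. \<Sum>j<d2. cnj (y i) * cnj (E (F * G) $$ (j,i)) * x j) = cnj S"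
    unfolding S_def cnj_sum by (subst sum.swap) (simp add: mult_ac)
  have quad: "(\<Sum>i<2 * d2. \<Sum>j<2 * d2. cnj (w i) * M $$ (i,j) * w j)
      = (\<Sum>i<d2. \<Sum>j<d2. cnj (x i) * E (F * mat_adjoint F) $$ (i,j) * x j) + S
      + (cnj S + (\<Sum>i<d2. \<Sum>j<d2. cnj (y i) * E (mat_adjoint G * G) $$ (i,j) * y j))"
    unfolding mult_2 sum_lessThan_add sum.distrib S_def cross[unfolded S_def, symmetric]
    by (simp add: w_def M00 M01 M10 M11)
  show ?thesis
    using psd_quadratic_form[OF M, of w]
    unfolding quad plus_complex.sel cnj.sel S_def[symmetric] by linarith
qed

text \<open>Two-positivity turns the Cauchy--Schwarz inequality for the factorisation F * G into a bound on
  the image, which replaces the contraction property of the dual map.\<close>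
lemma channel_mtrace_bound:
  assumes E: "channel d1 d2 E" and F: "F \<in> carrier_mat d1 d1" and G: "G \<in> carrier_mat d1 d1"
    and A: "A \<in> carrier_mat d2 d2" and B: "B \<in> carrier_mat d2 d2"
  shows "2 * cmod (mtrace (A * E (F * G) * B)) \<le>
    Re (mtrace (A * E (F * mat_adjoint F) * mat_adjoint A)) + Re (mtrace (mat_adjoint B * E (mat_adjoint G * G) * B))"
proof -
  define z where "z = mtrace (A * E (F * G) * B)"
  \<comment> \<open>A phase that turns \<open>z\<close> into minus its modulus. It is put into the
    first vector only, so it survives in the cross term and cancels in the two diagonal
    terms.\<close>
  define c where "c = (if z = 0 then 1 else - cnj (sgn z))"
  have c: "c * cnj c = 1" and cz: "Re (c * z) = - cmod z"
  proof -
    show "c * cnj c = 1"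
      by (cases "z = 0") (simp_all add: c_def complex_norm_square[symmetric] norm_sgn mult.commute)
    show "Re (c * z) = - cmod z"
    proof (cases "z = 0")
      case False
      have "cnj (sgn z) * z = of_real (cmod z)"
        using False by (simp add: sgn_eq complex_norm_square[symmetric] mult.commute power2_eq_square)
      then show ?thesis using False by (simp add: c_def)
    qed (simp add: c_def)
  qed
  have FF: "E (F * mat_adjoint F) \<in> carrier_mat d2 d2" and FG: "E (F * G) \<in> carrier_mat d2 d2"
    and GG: "E (mat_adjoint G * G) \<in> carrier_mat d2 d2"
    using F G by (auto intro!: channel_carrier[OF E])
  have [simp]: "dim_row A = d2" "dim_col A = d2" "dim_row B = d2" "dim_col B = d2" using A B by auto
  have tA: "mtrace (A * E (F * mat_adjoint F) * mat_adjoint A)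
      = (\<Sum>k<d2. \<Sum>i<d2. \<Sum>j<d2. A $$ (k,i) * E (F * mat_adjoint F) $$ (i,j) * cnj (A $$ (k,j)))"
    unfolding mtrace_mult3[OF A FF adjoint_carrier[OF A]] by (intro sum.cong refl) simp
  have tB: "mtrace (mat_adjoint B * E (mat_adjoint G * G) * B)
      = (\<Sum>k<d2. \<Sum>i<d2. \<Sum>j<d2. cnj (B $$ (i,k)) * E (mat_adjoint G * G) $$ (i,j) * B $$ (j,k))"
    unfolding mtrace_mult3[OF adjoint_carrier[OF B] GG B] by (intro sum.cong refl) simp
  have cc: "c * a * p * (cnj c * b) = a * p * b" for a p b
    using c by (simp add: algebra_simps)
  \<comment> \<open>Both traces are sums of quadratic forms, one for each row of \<open>A\<close>
    paired with the column of \<open>B\<close> of the same index.\<close>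
  have "0 \<le> (\<Sum>k<d2. Re (\<Sum>i<d2. \<Sum>j<d2. A $$ (k,i) * E (F * mat_adjoint F) $$ (i,j) * cnj (A $$ (k,j)))
      + 2 * Re (\<Sum>i<d2. \<Sum>j<d2. c * A $$ (k,i) * E (F * G) $$ (i,j) * B $$ (j,k))
      + Re (\<Sum>i<d2. \<Sum>j<d2. cnj (B $$ (i,k)) * E (mat_adjoint G * G) $$ (i,j) * B $$ (j,k)))"
    (is "0 \<le> (\<Sum>k<d2. ?q k)")
  proof (rule sum_nonneg)
    fix k assume "k \<in> {..<d2}"
    show "0 \<le> ?q k"
      using channel_quadratic_form[OF E F G, of "\<lambda>i. cnj (c * A $$ (k,i))" "\<lambda>j. B $$ (j,k)"]
      by (simp only: complex_cnj_cnj complex_cnj_mult cc)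
  qed
  also have "\<dots> = Re (mtrace (A * E (F * mat_adjoint F) * mat_adjoint A)) + 2 * Re (c * z)
      + Re (mtrace (mat_adjoint B * E (mat_adjoint G * G) * B))"
    unfolding tA tB z_def mtrace_mult3[OF A FG B]
    by (simp only: sum.distrib Re_sum[symmetric] sum_distrib_left[symmetric] mult.assoc)
  finally show ?thesis unfolding cz z_def[symmetric] by linarith
qed

text \<open>Every entry of the image is a fixed linear combination of the entries of the argument;
  this is how holomorphy passes through a channel.\<close>

lemma channel_index_expansion:
  assumes E: "channel d1 d2 E"
  shows "\<exists>K. \<forall>X\<in>carrier_mat d1 d1. \<forall>i<d2. \<forall>j<d2.
    E X $$ (i,j) = (\<Sum>p\<in>{..<d1} \<times> {..<d1}. X $$ p * K p i j)"
proof -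
  define e where "e p = mat d1 d1 (\<lambda>q. if q = p then 1 else 0 :: complex)" for p
  have eC: "e p \<in> carrier_mat d1 d1" for p by (simp add: e_def)
  have "E X $$ (i,j) = (\<Sum>p\<in>{..<d1} \<times> {..<d1}. X $$ p * E (e p) $$ (i,j))"
    if X: "X \<in> carrier_mat d1 d1" and ij: "i < d2" "j < d2" for X i j
  proof -
    \<comment> \<open>Linearity is given for two summands only, so the support of the matrix is
      built up one entry at a time.\<close>
    define Y where "Y S = mat d1 d1 (\<lambda>q. if q \<in> S then X $$ q else 0)" for S
    have YC: "Y S \<in> carrier_mat d1 d1" for S by (simp add: Y_def)
    have "E (Y S) $$ (i,j) = (\<Sum>p\<in>S. X $$ p * E (e p) $$ (i,j))" if "finite S" for S
      using that
    proof (induction S rule: finite_induct)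
      case empty
      have "Y {} = 0 \<cdot>\<^sub>m X + 0 \<cdot>\<^sub>m X" using X by (intro eq_matI) (auto simp: Y_def)
      then show ?case
        using channel_carrier[OF E X] ij by (simp add: channel_linear[OF E X X])
    next
      case (insert p S)
      have "Y (insert p S) = (X $$ p) \<cdot>\<^sub>m e p + 1 \<cdot>\<^sub>m Y S"
        using insert(2) by (intro eq_matI) (auto simp: Y_def e_def)
      then show ?case
        using channel_carrier[OF E eC[of p]] channel_carrier[OF E YC[of S]] ij insert
        by (simp add: channel_linear[OF E eC YC])
    qed
    moreover have "Y ({..<d1} \<times> {..<d1}) = X" using X by (intro eq_matI) (auto simp: Y_def)
    ultimately show ?thesis by (metis finite_SigmaI finite_lessThan)
  qed
  then show ?thesis by (intro exI[of _ "\<lambda>p i j. E (e p) $$ (i,j)"]) blast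
qed

section \<open>Unitary matrices, complex powers and holomorphic matrix families\<close>

lemma unitary_spec:
  assumes U: "unitary n U" and c: "\<And>i. i < n \<Longrightarrow> cmod (c i) = 1"
  shows "unitary n (spec n U c)"
proof -
  have "c i * cnj (c i) = 1" if "i < n" for i
    using c[OF that] by (simp add: complex_norm_square[symmetric])
  then show ?thesis
    unfolding unitary_def using U by (simp add: spec_adjoint spec_mult_eq_one mult.commute)
qed

lemma mtrace_unitary_conj:
  assumes "unitary n U" "A \<in> carrier_mat n n"
  shows "mtrace (U * A * mat_adjoint U) = mtrace A"
proof -
  have [simp]: "U \<in> carrier_mat n n" using assms by (simp add: unitary_def)
  have "mtrace (U * A * mat_adjoint U) = mtrace (mat_adjoint U * (U * A))"
    using assms by (intro mtrace_comm[of _ n n]) auto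
  also have "mat_adjoint U * (U * A) = (mat_adjoint U * U) * A"
    using assms by (simp add: assoc_mult_mat[of _ n n _ n _ n])
  finally show ?thesis using assms by (simp add: unitary_def left_mult_one_mat[of _ n n])
qed

text \<open>For positive \<open>a i\<close> this is the power of \<open>a i\<close> with exponent u
  + v z, written as an exponential so that it is entire in z and its modulus depends on Re z
  only.\<close>

definition cpow :: "(nat \<Rightarrow> real) \<Rightarrow> real \<Rightarrow> real \<Rightarrow> complex \<Rightarrow> nat \<Rightarrow> complex" where
  "cpow a u v z i = exp (of_real (u * ln (a i)) + of_real (v * ln (a i)) * z)"

lemma cpow_mult: "cpow a u v z i * cpow a u' v' z i = cpow a (u + u') (v + v') z i"
  by (simp add: cpow_def exp_add[symmetric] algebra_simps)

lemma cmod_cpow: "0 < a i \<Longrightarrow> cmod (cpow a u v z i) = a i powr (u + v * Re z)"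
  by (simp add: cpow_def powr_def algebra_simps)

lemma cpow_of_real: "0 < a i \<Longrightarrow> cpow a u v (of_real x) i = of_real (a i powr (u + v * x))"
  unfolding cpow_def by (simp add: powr_def exp_of_real[symmetric] algebra_simps)

lemma cpow_mult_cnj: "0 < a i \<Longrightarrow> cpow a u v z i * cnj (cpow a u v z i) = of_real (a i powr (2 * (u + v * Re z)))"
proof -
  assume a: "0 < a i"
  have "cpow a u v z i * cnj (cpow a u v z i) = of_real ((a i powr (u + v * Re z))\<^sup>2)"
    using cmod_cpow[of a i u v z] a by (simp add: complex_norm_square[symmetric])
  then show ?thesis using a by (simp add: power2_eq_square powr_add[symmetric])
qed

definition strip_holomorphic_mat :: "nat \<Rightarrow> (complex \<Rightarrow> complex mat) \<Rightarrow> bool" where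
  "strip_holomorphic_mat n M \<longleftrightarrow>
    (\<forall>z. M z \<in> carrier_mat n n) \<and> (\<forall>i<n. \<forall>j<n. strip_holomorphic (\<lambda>z. M z $$ (i,j)))"

lemma strip_holomorphic_mat_mult:
  assumes M: "strip_holomorphic_mat n M" and N: "strip_holomorphic_mat n N"
  shows "strip_holomorphic_mat n (\<lambda>z. M z * N z)"
proof -
  have "(M z * N z) $$ (i,j) = (\<Sum>l<n. M z $$ (i,l) * N z $$ (l,j))" if "i < n" "j < n" for z i j
    using M N that by (intro index_mult_sum) (auto simp: strip_holomorphic_mat_def)
  then show ?thesis
    using M N unfolding strip_holomorphic_mat_def
    by (auto simp del: index_mult_mat(1) intro!: strip_holomorphic_sum strip_holomorphic_mult)
qed

lemma strip_holomorphic_cpow: "strip_holomorphic (\<lambda>z. cpow a u v z i)"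
  unfolding cpow_def by (rule strip_holomorphic_exp)

lemma strip_holomorphic_mat_cpow:
  assumes U: "unitary n U"
  shows "strip_holomorphic_mat n (\<lambda>z. spec n U (cpow a u v z))"
  unfolding strip_holomorphic_mat_def
  by (auto simp: spec_index[OF U] spec_carrier[OF U]
      intro!: strip_holomorphic_sum strip_holomorphic_mult strip_holomorphic_cpow strip_holomorphic_const)

lemma strip_holomorphic_mat_channel:
  assumes E: "channel d1 d2 E" and M: "strip_holomorphic_mat d1 M"
  shows "strip_holomorphic_mat d2 (\<lambda>z. E (M z))"
proof -
  obtain K where K: "\<And>X i j. X \<in> carrier_mat d1 d1 \<Longrightarrow> i < d2 \<Longrightarrow> j < d2 \<Longrightarrow>
      E X $$ (i,j) = (\<Sum>p\<in>{..<d1} \<times> {..<d1}. X $$ p * K p i j)"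
    using channel_index_expansion[OF E] by blast
  have MC: "M z \<in> carrier_mat d1 d1" for z using M by (simp add: strip_holomorphic_mat_def)
  show ?thesis
    using M unfolding strip_holomorphic_mat_def
    by (auto simp: K[OF MC] channel_carrier[OF E]
        intro!: strip_holomorphic_sum strip_holomorphic_mult strip_holomorphic_const)
qed

lemma strip_holomorphic_mtrace:
  assumes "strip_holomorphic_mat n M"
  shows "strip_holomorphic (\<lambda>z. mtrace (M z))"
  using assms unfolding strip_holomorphic_mat_def
  by (auto simp: mtrace_carrier[of _ n n] intro!: strip_holomorphic_sum)

text \<open>Stein interpolation for the map dual to the channel, conjugated by powers of the reference
  state and its image: on \<open>Re z = 0\<close> it is a contraction in operator norm, on \<open>Re z = 1\<close> in trace norm.\<close>
lemma channel_interpolation: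
  assumes E: "channel d1 d2 E"
    and U: "unitary d1 U" and V: "unitary d1 V" and U': "unitary d2 U'" and W: "unitary d2 W"
    and a: "\<And>i. i < d1 \<Longrightarrow> 0 < a i" and h: "\<And>i. i < d1 \<Longrightarrow> 0 < h i"
    and b: "\<And>i. i < d2 \<Longrightarrow> 0 < b i" and t: "\<And>i. i < d2 \<Longrightarrow> 0 < t i"
    and E\<sigma>: "E (spec d1 U (\<lambda>i. of_real (a i))) = spec d2 U' (\<lambda>i. of_real (b i))"
    and \<theta>: "0 < \<theta>" "\<theta> < 1" and d: "0 < d1" "0 < d2"
  defines "A \<equiv> spec d1 U (\<lambda>i. of_real (a i powr (\<theta> / 2)))"
    and "B \<equiv> spec d2 U' (\<lambda>i. of_real (b i powr (- (\<theta> / 2))))"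
  shows "Re (mtrace (E (A * spec d1 V (\<lambda>i. of_real (h i)) * A) * (B * spec d2 W (\<lambda>i. of_real (t i)) * B)))
    \<le> (\<Sum>i<d1. h i powr (1 / (1 - \<theta>))) powr (1 - \<theta>) * (\<Sum>i<d2. t i powr (1 / \<theta>)) powr \<theta>"
proof -
  define \<beta> p where "\<beta> = 1 / (1 - \<theta>)" and "p = 1 / \<theta>"
  \<comment> \<open>The families are \<sigma>1^(z/2), h^(\<beta>(1-z)), the square root of the
    latter, \<sigma>2^(-z/2), t^(pz) and its square root. At z = \<theta> they become the matrices
    of the statement, since \<beta>(1-\<theta>) = 1 and p\<theta> = 1. On Re z = 0 all but
    \<open>Hz\<close> and \<open>Kz\<close> are unitary; on Re z = 1 \<open>Hz\<close> is.\<close>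
  define Az Hz Kz Bz Sz Tz where
    "Az z = spec d1 U (cpow a 0 (1/2) z)" and "Hz z = spec d1 V (cpow h \<beta> (-\<beta>) z)" and
    "Kz z = spec d1 V (cpow h (\<beta>/2) (-(\<beta>/2)) z)" and "Bz z = spec d2 U' (cpow b 0 (-1/2) z)" and
    "Sz z = spec d2 W (cpow t 0 p z)" and "Tz z = spec d2 W (cpow t 0 (p/2) z)" for z
  note defs = Az_def Hz_def Kz_def Bz_def Sz_def Tz_def
  have car [simp]: "Az z \<in> carrier_mat d1 d1" "Hz z \<in> carrier_mat d1 d1" "Kz z \<in> carrier_mat d1 d1"
    "Bz z \<in> carrier_mat d2 d2" "Sz z \<in> carrier_mat d2 d2" "Tz z \<in> carrier_mat d2 d2" for z
    by (simp_all add: defs spec_carrier U V U' W)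
  have KK: "Kz z * Kz z = Hz z" for z by (simp add: defs spec_mult[OF V] cpow_mult)
  have TT: "Tz z * Tz z = Sz z" for z by (simp add: defs spec_mult[OF W] cpow_mult)
  note nz = a[THEN less_imp_neq, symmetric] h[THEN less_imp_neq, symmetric]
    b[THEN less_imp_neq, symmetric] t[THEN less_imp_neq, symmetric]
    a[THEN abs_of_pos] h[THEN abs_of_pos] b[THEN abs_of_pos] t[THEN abs_of_pos]
  note assoc1 = assoc_mult_mat[of _ d1 d1 _ d1 _ d1] and assoc2 = assoc_mult_mat[of _ d2 d2 _ d2 _ d2]
  define g where "g z = mtrace (E (Az z * Hz z * Az z) * (Bz z * Sz z * Bz z))" for z
  define M0 M1 where "M0 = (\<Sum>i<d1. h i powr \<beta>)" and "M1 = (\<Sum>i<d2. t i powr p)"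
  have "0 < M0" unfolding M0_def using d by (intro sum_pos) (auto dest: h)
  moreover have "0 < M1" unfolding M1_def using d by (intro sum_pos) (auto dest: t)
  moreover have "strip_holomorphic g"
    unfolding g_def defs
    by (intro strip_holomorphic_mtrace[where n = d2] strip_holomorphic_mat_mult
        strip_holomorphic_mat_channel[OF E] strip_holomorphic_mat_cpow U V U' W)
  moreover have "cmod (g (Complex 0 s)) \<le> M0" for s
  proof -
    let ?z = "Complex 0 s"
    have uA: "unitary d1 (Az ?z)" unfolding defs using a by (intro unitary_spec[OF U]) (simp add: cmod_cpow nz)
    have "unitary d2 (Bz ?z)" unfolding defs using b by (intro unitary_spec[OF U']) (simp add: cmod_cpow nz)
    moreover have "unitary d2 (Sz ?z)" unfolding defs using t by (intro unitary_spec[OF W]) (simp add: cmod_cpow nz)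
    ultimately have uC: "unitary d2 (Bz ?z * Sz ?z * Bz ?z)" by (intro unitary_mult)
    \<comment> \<open>Splitting \<open>Hz\<close> evenly gives both factors the same squared
      Hilbert--Schmidt norm \<open>M0\<close>, and the trace preserving channel leaves it
      unchanged.\<close>
    have F: "Az ?z * Kz ?z \<in> carrier_mat d1 d1" and G: "Kz ?z * Az ?z \<in> carrier_mat d1 d1" by simp_all
    have FG: "Az ?z * Kz ?z * (Kz ?z * Az ?z) = Az ?z * Hz ?z * Az ?z"
      by (simp add: KK[symmetric] assoc1)
    have KK': "mtrace (Kz ?z * mat_adjoint (Kz ?z)) = of_real M0"
      unfolding defs spec_adjoint[OF V] spec_mult[OF V] mtrace_spec[OF V] M0_def of_real_sum
      using h by (intro sum.cong refl) (simp add: cpow_mult_cnj nz)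
    have trF: "mtrace (Az ?z * Kz ?z * mat_adjoint (Az ?z * Kz ?z)) = of_real M0"
    proof -
      have "Az ?z * Kz ?z * mat_adjoint (Az ?z * Kz ?z) = Az ?z * (Kz ?z * mat_adjoint (Kz ?z)) * mat_adjoint (Az ?z)"
        by (simp add: adjoint_mult[of _ d1 d1 _ d1] assoc1)
      then show ?thesis using KK' by (simp add: mtrace_unitary_conj[OF uA])
    qed
    have trG: "mtrace (mat_adjoint (Kz ?z * Az ?z) * (Kz ?z * Az ?z)) = of_real M0"
    proof -
      have "mat_adjoint (Kz ?z * Az ?z) * (Kz ?z * Az ?z)
          = mat_adjoint (Az ?z) * (mat_adjoint (Kz ?z) * Kz ?z) * mat_adjoint (mat_adjoint (Az ?z))"
        by (simp add: adjoint_mult[of _ d1 d1 _ d1] assoc1)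
      then show ?thesis using KK' mtrace_comm[of "Kz ?z" d1 d1 "mat_adjoint (Kz ?z)"]
        by (simp add: mtrace_unitary_conj[OF unitary_adjoint[OF uA]] del: adjoint_adjoint)
    qed
    have EC: "E X \<in> carrier_mat d2 d2" if "X \<in> carrier_mat d1 d1" for X
      using that by (rule channel_carrier[OF E])
    have "2 * cmod (mtrace ((Bz ?z * Sz ?z * Bz ?z) * E (Az ?z * Kz ?z * (Kz ?z * Az ?z)) * 1\<^sub>m d2)) \<le> M0 + M0"
      using channel_mtrace_bound[OF E F G unitary_carrier[OF uC] one_carrier_mat] EC F G
      by (simp add: mtrace_unitary_conj[OF uC] channel_mtrace[OF E] trF trG
          left_mult_one_mat[of _ d2 d2] right_mult_one_mat[of _ d2 d2])
    also have "mtrace ((Bz ?z * Sz ?z * Bz ?z) * E (Az ?z * Kz ?z * (Kz ?z * Az ?z)) * 1\<^sub>m d2) = g ?z"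
      unfolding FG g_def
      by (subst mtrace_comm[of _ d2 d2]) (simp_all add: EC right_mult_one_mat[of _ d2 d2] left_mult_one_mat[of _ d2 d2])
    finally show ?thesis by simp
  qed
  moreover have "cmod (g (Complex 1 s)) \<le> M1" for s
  proof -
    let ?z = "Complex 1 s"
    have uH: "unitary d1 (Hz ?z)" unfolding defs using h by (intro unitary_spec[OF V]) (simp add: cmod_cpow nz)
    \<comment> \<open>With \<open>Hz\<close> unitary, the factorisation into \<open>Az * Hz\<close>
      and \<open>Az\<close> has both outer products equal to the first reference state. The channel
      sends it to the second one, which the factors \<open>Bz\<close> on either side reduce to the
      identity, so that only \<open>Tz\<close> contributes.\<close>
    have F: "Az ?z * Hz ?z \<in> carrier_mat d1 d1" by simp
    have EC: "E X \<in> carrier_mat d2 d2" if "X \<in> carrier_mat d1 d1" for X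
      using that by (rule channel_carrier[OF E])
    have AA: "Az ?z * mat_adjoint (Az ?z) = spec d1 U (\<lambda>i. of_real (a i))"
      and AA': "mat_adjoint (Az ?z) * Az ?z = spec d1 U (\<lambda>i. of_real (a i))"
      unfolding defs spec_adjoint[OF U] spec_mult[OF U]
      using a by (auto intro!: spec_cong[OF U] simp: cpow_mult_cnj nz mult.commute[of "cnj _"])
    have FF: "Az ?z * Hz ?z * mat_adjoint (Az ?z * Hz ?z) = spec d1 U (\<lambda>i. of_real (a i))"
    proof -
      have "Az ?z * Hz ?z * mat_adjoint (Az ?z * Hz ?z) = Az ?z * (Hz ?z * mat_adjoint (Hz ?z)) * mat_adjoint (Az ?z)"
        by (simp add: adjoint_mult[of _ d1 d1 _ d1] assoc1)
      then show ?thesis using uH AA by (simp add: unitary_def right_mult_one_mat[of _ d1 d1])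
    qed
    define s2 where "s2 = spec d2 U' (\<lambda>i. of_real (b i))"
    have s2C [simp]: "s2 \<in> carrier_mat d2 d2" by (simp add: s2_def spec_carrier[OF U'])
    have BsB: "Bz ?z * s2 * mat_adjoint (Bz ?z) = 1\<^sub>m d2" "mat_adjoint (Bz ?z) * s2 * Bz ?z = 1\<^sub>m d2"
    proof -
      have *: "cpow b 0 (-1/2) ?z i * cnj (cpow b 0 (-1/2) ?z i) * of_real (b i) = 1" if "i < d2" for i
        unfolding cpow_mult_cnj[of b i, OF b[OF that]] using b[OF that]
        by (simp add: powr_minus nz that flip: of_real_mult)
      show "Bz ?z * s2 * mat_adjoint (Bz ?z) = 1\<^sub>m d2" "mat_adjoint (Bz ?z) * s2 * Bz ?z = 1\<^sub>m d2"
        unfolding defs s2_def spec_adjoint[OF U'] spec_mult[OF U'] spec_one[OF U', symmetric]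
        using * by (auto intro!: spec_cong[OF U'] simp: mult_ac)
    qed
    have T1: "mtrace (Tz ?z * mat_adjoint (Tz ?z)) = of_real M1"
      unfolding defs spec_adjoint[OF W] spec_mult[OF W] mtrace_spec[OF W] M1_def of_real_sum
      using t by (intro sum.cong refl) (simp add: cpow_mult_cnj nz)
    then have T2: "mtrace (mat_adjoint (Tz ?z) * Tz ?z) = of_real M1"
      using mtrace_comm[of "Tz ?z" d2 d2 "mat_adjoint (Tz ?z)"] by simp
    have R: "Tz ?z * Bz ?z * s2 * mat_adjoint (Tz ?z * Bz ?z) = Tz ?z * mat_adjoint (Tz ?z)"
    proof -
      have "Tz ?z * Bz ?z * s2 * mat_adjoint (Tz ?z * Bz ?z) = Tz ?z * (Bz ?z * s2 * mat_adjoint (Bz ?z)) * mat_adjoint (Tz ?z)"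
        by (simp add: adjoint_mult[of _ d2 d2 _ d2] assoc2)
      then show ?thesis by (simp add: BsB right_mult_one_mat[of _ d2 d2])
    qed
    have L: "mat_adjoint (Bz ?z * Tz ?z) * s2 * (Bz ?z * Tz ?z) = mat_adjoint (Tz ?z) * Tz ?z"
    proof -
      have "mat_adjoint (Bz ?z * Tz ?z) * s2 * (Bz ?z * Tz ?z) = mat_adjoint (Tz ?z) * (mat_adjoint (Bz ?z) * s2 * Bz ?z) * Tz ?z"
        by (simp add: adjoint_mult[of _ d2 d2 _ d2] assoc2)
      then show ?thesis by (simp add: BsB right_mult_one_mat[of _ d2 d2])
    qed
    have "2 * cmod (mtrace (Tz ?z * Bz ?z * E (Az ?z * Hz ?z * Az ?z) * (Bz ?z * Tz ?z))) \<le> M1 + M1"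
      using channel_mtrace_bound[OF E F car(1), of "Tz ?z * Bz ?z" "Bz ?z * Tz ?z" ?z]
      unfolding FF AA' E\<sigma> s2_def[symmetric] R L T1 T2 by simp
    also have "mtrace (Tz ?z * Bz ?z * E (Az ?z * Hz ?z * Az ?z) * (Bz ?z * Tz ?z)) = g ?z"
    proof -
      have "mtrace (Tz ?z * Bz ?z * E (Az ?z * Hz ?z * Az ?z) * (Bz ?z * Tz ?z))
          = mtrace (Tz ?z * Bz ?z * (E (Az ?z * Hz ?z * Az ?z) * (Bz ?z * Tz ?z)))"
        by (simp add: assoc2 EC)
      also have "\<dots> = mtrace (E (Az ?z * Hz ?z * Az ?z) * (Bz ?z * Tz ?z) * (Tz ?z * Bz ?z))"
        by (rule mtrace_comm[of _ d2 d2]) (simp_all add: EC)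
      also have "E (Az ?z * Hz ?z * Az ?z) * (Bz ?z * Tz ?z) * (Tz ?z * Bz ?z)
          = E (Az ?z * Hz ?z * Az ?z) * (Bz ?z * (Tz ?z * Tz ?z) * Bz ?z)"
        by (simp add: assoc2 EC)
      finally show ?thesis by (simp add: g_def TT)
    qed
    finally show ?thesis by simp
  qed
  ultimately have bound: "cmod (g (of_real \<theta>)) \<le> M0 powr (1 - \<theta>) * M1 powr \<theta>"
    using \<theta> by (intro three_lines)
  have "Az (of_real \<theta>) = A"
    unfolding defs A_def using a by (intro spec_cong[OF U]) (simp add: cpow_of_real nz)
  moreover have "Bz (of_real \<theta>) = B"
    unfolding defs B_def using b by (intro spec_cong[OF U']) (simp add: cpow_of_real nz)
  moreover have "Hz (of_real \<theta>) = spec d1 V (\<lambda>i. of_real (h i))"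
  proof -
    have "\<beta> + - \<beta> * \<theta> = 1" using \<theta> by (simp add: \<beta>_def field_simps)
    then show ?thesis unfolding defs using h by (intro spec_cong[OF V]) (simp add: cpow_of_real nz)
  qed
  moreover have "Sz (of_real \<theta>) = spec d2 W (\<lambda>i. of_real (t i))"
    unfolding defs using t \<theta> by (intro spec_cong[OF W]) (simp add: cpow_of_real p_def nz)
  ultimately have "g (of_real \<theta>) = mtrace (E (A * spec d1 V (\<lambda>i. of_real (h i)) * A) * (B * spec d2 W (\<lambda>i. of_real (t i)) * B))"
    by (simp add: g_def)
  then show ?thesis
    using bound complex_Re_le_cmod[of "g (of_real \<theta>)"] by (simp add: M0_def M1_def \<beta>_def p_def)
qed

section \<open>Trace norm and fidelity\<close>

declare minus_carrier_mat [simp] add_carrier_mat [simp] smult_carrier_mat [simp]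

lemma mat_add_diff_cancel:
  fixes X Y :: "'a::ab_group_add mat"
  assumes "X \<in> carrier_mat n m" "Y \<in> carrier_mat n m"
  shows "X + Y - Y = X" and mat_diff_diff_self: "X - (Y - Y) = X"
  using assms by (auto intro!: eq_matI)

lemma mat_diff_add_diff:
  fixes X Y Z :: "'a::ab_group_add mat"
  assumes "X \<in> carrier_mat n m" "Y \<in> carrier_mat n m" "Z \<in> carrier_mat n m"
  shows "(X - Y) + (Y - Z) = X - Z"
  using assms by (auto intro!: eq_matI)

lemma psd_carrier: "psd n A \<Longrightarrow> A \<in> carrier_mat n n" and psd_hermitian: "psd n A \<Longrightarrow> mat_adjoint A = A"
  by (simp_all add: psd_def)

lemma psd_spec:
  assumes U: "unitary n U" and l: "\<And>i. i < n \<Longrightarrow> 0 \<le> l i"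
  shows "psd n (spec n U (\<lambda>i. of_real (l i)))"
proof -
  have "spec n U (\<lambda>i. of_real (sqrt (l i))) * mat_adjoint (spec n U (\<lambda>i. of_real (sqrt (l i))))
      = spec n U (\<lambda>i. of_real (l i))"
    unfolding spec_adjoint[OF U] spec_mult[OF U] using l
    by (intro spec_cong[OF U]) (simp flip: of_real_mult)
  then show ?thesis using psd_mult_adjoint_self[OF spec_carrier[OF U]] by metis
qed

lemma psd_conj:
  assumes P: "psd n A" and B: "B \<in> carrier_mat n n"
  shows "psd n (B * A * mat_adjoint B)"
proof -
  obtain U l where U: "unitary n U" and A: "A = spec n U (\<lambda>i. of_real (l i))"
    using hermitian_spectral_decomposition psd_carrier[OF P] psd_hermitian[OF P] by blast
  have l: "0 \<le> l i" if "i < n" for i using psd_spec_nonneg[OF U _ that] P A by simp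
  define R where "R = spec n U (\<lambda>i. of_real (sqrt (l i)))"
  have [simp]: "R \<in> carrier_mat n n" by (simp add: R_def spec_carrier[OF U])
  have R: "R * mat_adjoint R = A"
    unfolding R_def A spec_adjoint[OF U] spec_mult[OF U] using l
    by (intro spec_cong[OF U]) (simp flip: of_real_mult)
  have "B * A * mat_adjoint B = (B * R) * mat_adjoint (B * R)"
    unfolding R[symmetric] using B by (simp add: adjoint_mult[of _ n n _ n] assoc_mult_mat[of _ n n _ n _ n])
  then show ?thesis using psd_mult_adjoint_self[of "B * R" n n] B by simp
qed

lemma mtrace_spec_mult_psd_nonneg:
  assumes U: "unitary n U" and c: "\<And>i. i < n \<Longrightarrow> 0 \<le> c i" and A: "psd n A"
  shows "0 \<le> Re (mtrace (spec n U (\<lambda>i. of_real (c i)) * A))"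
proof -
  define R where "R = spec n U (\<lambda>i. of_real (sqrt (c i)))"
  have [simp]: "R \<in> carrier_mat n n" by (simp add: R_def spec_carrier[OF U])
  have [simp]: "A \<in> carrier_mat n n" using A by (rule psd_carrier)
  have R: "R * R = spec n U (\<lambda>i. of_real (c i))"
    unfolding R_def spec_mult[OF U] using c by (intro spec_cong[OF U]) (simp flip: of_real_mult)
  have Rh: "mat_adjoint R = R" by (simp add: R_def spec_adjoint[OF U])
  have "mtrace (spec n U (\<lambda>i. of_real (c i)) * A) = mtrace (R * (R * A))"
    by (simp add: R[symmetric] assoc_mult_mat[of _ n n _ n _ n])
  also have "\<dots> = mtrace (mat_adjoint R * A * R)"
    unfolding Rh by (subst mtrace_comm[of _ n n]) simp_all
  finally show ?thesis using psd_mtrace_conj[OF A, of R n] by simp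
qed

text \<open>The values sqrt (l i) are the singular values of \<open>X\<close>.\<close>

lemma trace_norm_decomposition:
  assumes X: "X \<in> carrier_mat n n"
  obtains W l where "unitary n W" "mat_adjoint X * X = spec n W (\<lambda>i. of_real (l i))"
    "\<And>i. i < n \<Longrightarrow> 0 \<le> l i" "trace_norm X = (\<Sum>i<n. sqrt (l i))"
proof -
  have XX: "mat_adjoint X * X \<in> carrier_mat n n" "mat_adjoint (mat_adjoint X * X) = mat_adjoint X * X"
    using X by (simp_all add: adjoint_mult[of _ n n _ n])
  obtain W l where W: "unitary n W" "mat_adjoint X * X = spec n W (\<lambda>i. of_real (l i))"
    and f: "\<And>f. mfun f (mat_adjoint X * X) = spec n W (\<lambda>i. of_real (f (l i)))"
    using mfun_spectral[OF XX] by blast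
  have "psd n (mat_adjoint X * X)"
    using psd_mult_adjoint_self[of "mat_adjoint X" n n] X by simp
  then have "0 \<le> l i" if "i < n" for i using psd_spec_nonneg[OF W(1) _ that] W(2) by simp
  moreover have "trace_norm X = (\<Sum>i<n. sqrt (l i))"
    by (simp add: trace_norm_def f mtrace_spec[OF W(1)])
  ultimately show thesis using W that by blast
qed

lemma trace_norm_nonneg: "X \<in> carrier_mat n n \<Longrightarrow> 0 \<le> trace_norm X"
  by (rule trace_norm_decomposition[of X n]) (auto intro!: sum_nonneg)

text \<open>Split off the square root of the modulus of \<open>X\<close> and apply Cauchy--Schwarz
  to the two factors; the unitary drops out of the first. The modulus may be singular, so it is
  shifted by \<open>\<epsilon>\<close> before it is inverted.\<close>

lemma Re_mtrace_unitary_mult_le_trace_norm: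
  assumes X: "X \<in> carrier_mat n n" and V: "unitary n V"
  shows "Re (mtrace (V * X)) \<le> trace_norm X"
proof -
  obtain W l where W: "unitary n W" and XX: "mat_adjoint X * X = spec n W (\<lambda>i. of_real (l i))"
    and l: "\<And>i. i < n \<Longrightarrow> 0 \<le> l i" and tn: "trace_norm X = (\<Sum>i<n. sqrt (l i))"
    using trace_norm_decomposition[OF X] by metis
  have [simp]: "V \<in> carrier_mat n n" "X \<in> carrier_mat n n" "spec n W c \<in> carrier_mat n n" for c
    using V X by (simp_all add: unitary_def spec_carrier[OF W])
  note assoc = assoc_mult_mat[of _ n n _ n _ n]
  have bound: "Re (mtrace (V * X)) \<le> trace_norm X + real n * \<epsilon> / 2" if "\<epsilon> > 0" for \<epsilon>
  proof -
    define c where "c i = sqrt (l i) + \<epsilon>" for i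
    have c: "0 < c i" if "i < n" for i using l[OF that] \<open>\<epsilon> > 0\<close> by (simp add: c_def add_nonneg_pos)
    define C where "C = spec n W (\<lambda>i. of_real (sqrt (c i)))"
    define C' where "C' = spec n W (\<lambda>i. of_real (1 / sqrt (c i)))"
    have [simp]: "C \<in> carrier_mat n n" "C' \<in> carrier_mat n n" by (simp_all add: C_def C'_def)
    have h: "mat_adjoint C = C" "mat_adjoint C' = C'" by (simp_all add: C_def C'_def spec_adjoint[OF W])
    have "C' * C = 1\<^sub>m n"
      unfolding C_def C'_def using c by (intro spec_mult_eq_one[OF W]) (auto dest: c simp flip: of_real_mult)
    then have "V * X = (V * X * C') * C" by (simp add: assoc right_mult_one_mat[of _ n n])
    then have "2 * Re (mtrace (V * X)) \<le> Re (mtrace ((V * X * C') * mat_adjoint (V * X * C'))) + Re (mtrace (C * C))"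
      using two_Re_mtrace_mult_le[of "V * X * C'" n n C] h by simp
    also have "mtrace ((V * X * C') * mat_adjoint (V * X * C')) = mtrace (V * (X * C' * mat_adjoint (X * C')) * mat_adjoint V)"
      by (simp add: assoc adjoint_mult[of _ n n _ n])
    also have "\<dots> = mtrace (X * C' * mat_adjoint (X * C'))"
      by (rule mtrace_unitary_conj[OF V]) simp
    also have "\<dots> = mtrace (mat_adjoint X * X * (C' * C'))"
      by (subst mtrace_comm[of _ n n], simp_all add: h assoc adjoint_mult[of _ n n _ n])
         (subst mtrace_comm[of _ n n], simp_all add: assoc)
    also have "\<dots> = of_real (\<Sum>i<n. l i / c i)"
      unfolding XX C'_def spec_mult[OF W] mtrace_spec[OF W] of_real_sum
      using c by (intro sum.cong refl) (simp add: less_imp_le flip: of_real_mult)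
    also have "mtrace (C * C) = of_real (\<Sum>i<n. c i)"
      unfolding C_def spec_mult[OF W] mtrace_spec[OF W] of_real_sum
      using c by (intro sum.cong refl) (simp add: less_imp_le flip: of_real_mult)
    finally have "2 * Re (mtrace (V * X)) \<le> (\<Sum>i<n. l i / c i) + (\<Sum>i<n. c i)" by simp
    also have "(\<Sum>i<n. l i / c i) \<le> (\<Sum>i<n. sqrt (l i))"
    proof (rule sum_mono)
      fix i assume "i \<in> {..<n}"
      then have i: "i < n" by simp
      have "l i = sqrt (l i) * sqrt (l i)" using l[OF i] by simp
      also have "\<dots> \<le> sqrt (l i) * c i" unfolding c_def using l[OF i] \<open>\<epsilon> > 0\<close> by (intro mult_left_mono) auto
      finally show "l i / c i \<le> sqrt (l i)" using c[OF i] by (simp add: divide_le_eq)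
    qed
    finally show ?thesis by (simp add: tn c_def sum.distrib)
  qed
  have "((\<lambda>\<epsilon>. trace_norm X + real n * \<epsilon> / 2) \<longlongrightarrow> trace_norm X + real n * 0 / 2) (at_right 0)"
    by (intro tendsto_intros) auto
  then have "Re (mtrace (V * X)) \<le> trace_norm X + real n * 0 / 2"
    by (rule tendsto_lowerbound) (auto simp: eventually_at_right_field intro!: exI[of _ 1] bound)
  then show ?thesis by simp
qed

text \<open>With the partial isometry \<open>Z\<close> of the polar decomposition the trace norm is
  tr (adjoint Z A B). Cauchy--Schwarz applies to (adjoint Z A) and \<open>B\<close>, and the factor
  adjoint Z can only decrease the Hilbert--Schmidt norm of \<open>A\<close>.\<close>

lemma trace_norm_mult_le:
  assumes A: "A \<in> carrier_mat n n" and B: "B \<in> carrier_mat n n"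
  shows "2 * trace_norm (A * B) \<le> Re (mtrace (A * mat_adjoint A)) + Re (mtrace (mat_adjoint B * B))"
proof -
  define X where "X = A * B"
  have X: "X \<in> carrier_mat n n" using A B by (simp add: X_def)
  obtain W l where W: "unitary n W" and XX: "mat_adjoint X * X = spec n W (\<lambda>i. of_real (l i))"
    and l: "\<And>i. i < n \<Longrightarrow> 0 \<le> l i" and tn: "trace_norm X = (\<Sum>i<n. sqrt (l i))"
    using trace_norm_decomposition[OF X] by metis
  have [simp]: "A \<in> carrier_mat n n" "B \<in> carrier_mat n n" "X \<in> carrier_mat n n" "spec n W c \<in> carrier_mat n n" for c
    using A B X by (simp_all add: spec_carrier[OF W])
  note assoc = assoc_mult_mat[of _ n n _ n _ n]
  \<comment> \<open>On the kernel of \<open>X\<close> the division by zero yields the pseudo-inverse, so \<open>Z\<close> is the partial isometry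
    of the polar decomposition.\<close>
  define c where "c i = 1 / sqrt (l i)" for i
  define C where "C = spec n W (\<lambda>i. of_real (c i))"
  define Z where "Z = X * C"
  have [simp]: "C \<in> carrier_mat n n" "Z \<in> carrier_mat n n" by (simp_all add: C_def Z_def)
  have Ch: "mat_adjoint C = C" by (simp add: C_def spec_adjoint[OF W])
  have Zadj: "mat_adjoint Z = C * mat_adjoint X" by (simp add: Z_def adjoint_mult[of _ n n _ n] Ch)
  have cl: "c i * l i = sqrt (l i)" if "i < n" for i
    using l[OF that] by (simp add: c_def real_div_sqrt)
  then have clc: "c i * (c i * l i * c i) = c i" if "i < n" for i
    using that by (simp add: c_def)
  have "mtrace (mat_adjoint Z * X) = mtrace (C * (mat_adjoint X * X))" by (simp add: Zadj assoc)
  also have "\<dots> = of_real (trace_norm X)"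
    unfolding XX C_def spec_mult[OF W] mtrace_spec[OF W] tn of_real_sum
    by (intro sum.cong refl) (simp only: of_real_mult[symmetric] cl lessThan_iff)
  finally have ZX: "mtrace (mat_adjoint Z * X) = of_real (trace_norm X)" .
  define Q where "Q = Z * mat_adjoint Z"
  have [simp]: "Q \<in> carrier_mat n n" by (simp add: Q_def)
  have Qh: "mat_adjoint Q = Q" by (simp add: Q_def adjoint_mult[of _ n n _ n])
  have QQ: "Q * Q = Q"
  proof -
    have "Q * Q = X * (C * (C * (mat_adjoint X * X) * C)) * mat_adjoint Z"
      by (simp add: Q_def Zadj) (simp add: Z_def assoc)
    also have "C * (C * (mat_adjoint X * X) * C) = C"
      unfolding XX C_def spec_mult[OF W]
      by (intro spec_cong[OF W]) (simp only: of_real_mult[symmetric] clc)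
    finally show ?thesis by (simp add: Q_def Z_def)
  qed
  \<comment> \<open>\<open>Q\<close> is an orthogonal projection, so what it removes from
    \<open>A\<close> has nonnegative squared norm tr (adjoint A A) - tr (adjoint A Q A).\<close>
  define N where "N = A - Q * A"
  have [simp]: "N \<in> carrier_mat n n" by (simp add: N_def)
  have "mat_adjoint N * N = mat_adjoint A * A - mat_adjoint A * Q * A"
  proof -
    have "mat_adjoint N = mat_adjoint A - mat_adjoint A * Q"
      by (simp add: N_def adjoint_minus[of _ n n] adjoint_mult[of _ n n _ n] Qh)
    then have "mat_adjoint N * N = (mat_adjoint A * A - mat_adjoint A * Q * A) - (mat_adjoint A * Q * A - mat_adjoint A * (Q * Q) * A)"
      by (simp add: N_def minus_mult_distrib_mat[of _ n n _ _ n] mult_minus_distrib_mat[of _ n n _ n] assoc)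
    also have "\<dots> = mat_adjoint A * A - mat_adjoint A * Q * A"
      unfolding QQ by (rule mat_diff_diff_self[of _ n n]) simp_all
    finally show ?thesis .
  qed
  then have "0 \<le> Re (mtrace (mat_adjoint A * A)) - Re (mtrace (mat_adjoint A * Q * A))"
    using mtrace_adjoint_mult_self_nonneg[of N n n] by (simp add: mtrace_minus[of _ n])
  moreover have "mtrace (mat_adjoint A * A) = mtrace (A * mat_adjoint A)" by (rule mtrace_comm[of _ n n]) simp_all
  moreover have "mtrace ((mat_adjoint Z * A) * mat_adjoint (mat_adjoint Z * A)) = mtrace (mat_adjoint A * Q * A)"
    by (subst mtrace_comm[of _ n n]) (simp_all add: adjoint_mult[of _ n n _ n] Q_def assoc)
  moreover have "2 * trace_norm X \<le> Re (mtrace ((mat_adjoint Z * A) * mat_adjoint (mat_adjoint Z * A))) + Re (mtrace (mat_adjoint B * B))"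
    using two_Re_mtrace_mult_le[of "mat_adjoint Z * A" n n B] ZX by (simp add: X_def assoc)
  ultimately show ?thesis by (simp add: X_def)
qed

section \<open>Square roots and the Powers--Stoermer inequality\<close>

lemma mfun_sqrt:
  assumes "psd n A"
  shows "psd n (mfun sqrt A)" "mfun sqrt A * mfun sqrt A = A"
proof -
  obtain U l where U: "unitary n U" and A: "A = spec n U (\<lambda>i. of_real (l i))"
    and f: "\<And>f. mfun f A = spec n U (\<lambda>i. of_real (f (l i)))"
    using mfun_spectral[OF psd_carrier[OF assms] psd_hermitian[OF assms]] by blast
  have l: "0 \<le> l i" if "i < n" for i using psd_spec_nonneg[OF U _ that] assms A by simp
  then show "psd n (mfun sqrt A)" unfolding f by (intro psd_spec[OF U]) simp
  show "mfun sqrt A * mfun sqrt A = A"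
    unfolding f spec_mult[OF U] using A l
    by (auto intro!: spec_cong[OF U] simp flip: of_real_mult)
qed

text \<open>With D = A - B and its sign \<open>S\<close>, tr (S (A^2 - B^2)) = tr (|D| (A + B)).
  This exceeds tr (D (A - B)) by twice tr (P B) + tr (M A), where \<open>P\<close> and
  \<open>M\<close> are the positive and negative parts of D, and it is at most the trace norm
  because \<open>S\<close> is unitary.\<close>

lemma powers_stoermer:
  assumes A: "psd n A" and B: "psd n B"
  shows "Re (mtrace ((A - B) * (A - B))) \<le> trace_norm (A * A - B * B)"
proof -
  have [simp]: "A \<in> carrier_mat n n" "B \<in> carrier_mat n n" using A B by (simp_all add: psd_carrier)
  define D where "D = A - B"
  have [simp]: "D \<in> carrier_mat n n" by (simp add: D_def)
  have "mat_adjoint D = D" using A B by (simp add: D_def adjoint_minus[of _ n n] psd_hermitian)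
  then obtain V \<delta> where V: "unitary n V" and D: "D = spec n V (\<lambda>i. of_real (\<delta> i))"
    using hermitian_spectral_decomposition[of D n] by auto
  have [simp]: "spec n V c \<in> carrier_mat n n" for c by (rule spec_carrier[OF V])
  \<comment> \<open>The sign is 1 rather than 0 on the kernel of \<open>D\<close>, which makes
    \<open>S\<close> unitary.\<close>
  define S P M where "S = spec n V (\<lambda>i. of_real (if \<delta> i \<ge> 0 then 1 else -1))"
    and "P = spec n V (\<lambda>i. of_real (max (\<delta> i) 0))" and "M = spec n V (\<lambda>i. of_real (max (- \<delta> i) 0))"
  have [simp]: "S \<in> carrier_mat n n" "P \<in> carrier_mat n n" "M \<in> carrier_mat n n" by (simp_all add: S_def P_def M_def)
  have S: "unitary n S" unfolding S_def by (intro unitary_spec[OF V]) simp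
  have SD: "S * D = P + M" and DS: "D * S = P + M" and PMD: "P * D - M * D = D * D"
  proof -
    show "S * D = P + M" "D * S = P + M"
      unfolding S_def P_def M_def D spec_mult[OF V] spec_add[OF V]
      by (auto intro!: spec_cong[OF V] simp: max_def)
    have "D * D + M * D = P * D"
      unfolding P_def M_def D spec_mult[OF V] spec_add[OF V]
      by (auto intro!: spec_cong[OF V] simp: max_def)
    then have "P * D - M * D = D * D + M * D - M * D" by simp
    also have "\<dots> = D * D" by (rule mat_add_diff_cancel[of _ n n]) simp_all
    finally show "P * D - M * D = D * D" .
  qed
  note assoc = assoc_mult_mat[of _ n n _ n _ n]
  \<comment> \<open>A noncommutative difference of squares, arranged so that each summand has
    \<open>D\<close> at one end and cyclicity of the trace brings it next to
    \<open>S\<close>.\<close>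
  have split: "A * A - B * B = D * A + B * D"
  proof -
    have "D * A + B * D = (A * A - B * A) + (B * A - B * B)"
      by (simp add: D_def minus_mult_distrib_mat[of _ n n _ _ n] mult_minus_distrib_mat[of _ n n _ n])
    also have "\<dots> = A * A - B * B" by (rule mat_diff_add_diff[of _ n n]) simp_all
    finally show ?thesis ..
  qed
  have "mtrace (S * (A * A - B * B)) = mtrace (S * D * A) + mtrace (S * (B * D))"
    unfolding split by (simp add: mult_add_distrib_mat[of _ n n _ n] mtrace_add[of _ n] assoc)
  also have "mtrace (S * (B * D)) = mtrace (B * D * S)" by (rule mtrace_comm[of _ n n]) simp_all
  also have "\<dots> = mtrace (D * S * B)" by (simp add: assoc mtrace_comm[of B n n])
  finally have e1: "mtrace (S * (A * A - B * B)) = mtrace (P * A) + mtrace (M * A) + (mtrace (P * B) + mtrace (M * B))"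
    unfolding SD DS by (simp add: add_mult_distrib_mat[of _ n n _ _ n] mtrace_add[of _ n])
  have e2: "mtrace (D * D) = mtrace (P * A) - mtrace (P * B) - (mtrace (M * A) - mtrace (M * B))"
    unfolding PMD[symmetric]
    by (simp add: D_def mult_minus_distrib_mat[of _ n n _ n] mtrace_minus[of _ n])
  have "0 \<le> Re (mtrace (P * B))" unfolding P_def by (intro mtrace_spec_mult_psd_nonneg[OF V _ B]) simp
  moreover have "0 \<le> Re (mtrace (M * A))" unfolding M_def by (intro mtrace_spec_mult_psd_nonneg[OF V _ A]) simp
  ultimately have "Re (mtrace (D * D)) \<le> Re (mtrace (S * (A * A - B * B)))"
    unfolding e1 e2 by simp
  also have "\<dots> \<le> trace_norm (A * A - B * B)"
    by (rule Re_mtrace_unitary_mult_le_trace_norm[OF _ S]) simp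
  finally show ?thesis by (simp add: D_def)
qed

text \<open>One half of the Fuchs--van de Graaf inequalities: apply Powers--Stoermer to the square
  roots and expand the square, whose cross term is at most the fidelity.\<close>

lemma trace_dist_ge_one_minus_fidelity:
  assumes "density n \<rho>" "density n \<omega>"
  shows "1 - trace_norm (mfun sqrt \<rho> * mfun sqrt \<omega>) \<le> trace_dist \<rho> \<omega>"
proof -
  define A B where "A = mfun sqrt \<rho>" and "B = mfun sqrt \<omega>"
  have A: "psd n A" "A * A = \<rho>" and B: "psd n B" "B * B = \<omega>"
    using assms mfun_sqrt by (auto simp: density_def A_def B_def)
  have [simp]: "A \<in> carrier_mat n n" "B \<in> carrier_mat n n" using A B by (simp_all add: psd_carrier)
  have "(A - B) * (A - B) = (\<rho> - B * A) - (A * B - \<omega>)"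
    unfolding A(2)[symmetric] B(2)[symmetric]
    by (simp add: minus_mult_distrib_mat[of _ n n _ _ n] mult_minus_distrib_mat[of _ n n _ n])
  moreover have "\<rho> \<in> carrier_mat n n" "\<omega> \<in> carrier_mat n n" using assms by (auto simp: density_def psd_def)
  moreover have "mtrace (B * A) = mtrace (A * B)" by (rule mtrace_comm[of _ n n]) simp_all
  ultimately have "Re (mtrace ((A - B) * (A - B))) = 2 - 2 * Re (mtrace (A * B))"
    using assms by (simp add: mtrace_minus[of _ n] density_def)
  moreover have "Re (mtrace (A * B)) \<le> trace_norm (A * B)"
    using Re_mtrace_unitary_mult_le_trace_norm[of "A * B" n "1\<^sub>m n"]
    by (simp add: unitary_def left_mult_one_mat[of _ n n])
  ultimately show ?thesis
    using powers_stoermer[OF A(1) B(1)] unfolding A(2) B(2) by (simp add: trace_dist_def A_def B_def)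
qed

section \<open>Sandwiched divergences\<close>

text \<open>The argument of the logarithm is kept apart because it may vanish, where the logarithm
  carries no information.\<close>

definition sandwiched_trace :: "real \<Rightarrow> complex mat \<Rightarrow> complex mat \<Rightarrow> real" where
  "sandwiched_trace \<alpha> \<rho> \<sigma> =
    (let S = mfun (\<lambda>x. x powr ((1 - \<alpha>) / (2 * \<alpha>))) \<sigma> in Re (mtrace (mfun (\<lambda>x. x powr \<alpha>) (S * \<rho> * S))))"

lemma sandwiched_eq: "\<alpha> \<noteq> 1 \<Longrightarrow> sandwiched \<alpha> \<rho> \<sigma> = 1 / (\<alpha> - 1) * log 2 (sandwiched_trace \<alpha> \<rho> \<sigma>)"
  by (simp add: sandwiched_def sandwiched_trace_def Let_def)

text \<open>Complete positivity at k = 1, where \<open>id_tensor\<close> reduces to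
  \<open>E\<close>.\<close>

lemma channel_psd:
  assumes E: "channel d1 d2 E" and X: "psd d1 X"
  shows "psd d2 (E X)"
proof -
  have XC: "X \<in> carrier_mat d1 d1" using X by (rule psd_carrier)
  have "block d1 X 0 0 = X" using XC by (intro eq_matI) (auto simp: block_def)
  then have "id_tensor 1 d1 d2 E X = E X"
    using channel_carrier[OF E XC] by (intro eq_matI) (auto simp: id_tensor_def)
  moreover have "psd (1 * d2) (id_tensor 1 d1 d2 E X)"
    using E X unfolding channel_def by (metis mult_1)
  ultimately show ?thesis by simp
qed

lemma channel_density: "channel d1 d2 E \<Longrightarrow> density d1 \<rho> \<Longrightarrow> density d2 (E \<rho>)"
  by (auto simp: density_def channel_psd channel_mtrace psd_carrier)

section \<open>The one-shot fidelity bound\<close>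

lemma square_le_of_scaled_sum:
  fixes F u v :: real
  assumes F: "0 \<le> F" and uv: "0 \<le> u" "0 \<le> v" and le: "\<And>c. 0 < c \<Longrightarrow> 2 * F \<le> c * u + v / c"
  shows "F\<^sup>2 \<le> u * v"
proof (cases "F = 0")
  case False
  then have F: "0 < F" using F by simp
  show ?thesis
  proof (cases "u = 0")
    case True
    \<comment> \<open>With u = 0 a large scale makes v / c smaller than F, which contradicts F >
      0.\<close>
    have "2 * F \<le> v * F / (v + 1)"
      using le[of "(v + 1) / F"] F uv True by (simp add: field_simps)
    also have "\<dots> \<le> F" using F uv by (simp add: divide_le_eq field_simps)
    finally show ?thesis using F by simp
  next
    case False
    \<comment> \<open>The scale F / u balances the first term against one of the two copies of F,
      which leaves the product bound without square roots.\<close>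
    then have "2 * F \<le> F + v * u / F" using le[of "F / u"] F uv by simp
    then have "F \<le> v * u / F" by simp
    then show ?thesis using F by (simp add: le_divide_eq power2_eq_square mult.commute)
  qed
qed (use uv in simp)

text \<open>Eigenvalues \<open>a\<close> of the reference state are strictly positive, so negative
  exponents s are meaningful. Those of the conjugated state are only nonnegative: conjugation by an
  invertible matrix keeps the kernel dimension of \<open>\<rho>\<close>.\<close>

lemma mfun_powr_conj:
  assumes \<sigma>: "density n \<sigma>" "pd n \<sigma>" and \<rho>: "density n \<rho>"
  obtains U a V h where "unitary n U" "unitary n V" "\<sigma> = spec n U (\<lambda>i. of_real (a i))"
    "\<And>i. i < n \<Longrightarrow> 0 < a i" "\<And>i. i < n \<Longrightarrow> 0 \<le> h i"
    "spec n U (\<lambda>i. of_real (a i powr s)) * \<rho> * spec n U (\<lambda>i. of_real (a i powr s)) = spec n V (\<lambda>i. of_real (h i))"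
    "Re (mtrace (mfun (\<lambda>x. x powr \<alpha>) (mfun (\<lambda>x. x powr s) \<sigma> * \<rho> * mfun (\<lambda>x. x powr s) \<sigma>))) = (\<Sum>i<n. h i powr \<alpha>)"
proof -
  have "\<sigma> \<in> carrier_mat n n" "mat_adjoint \<sigma> = \<sigma>" using \<sigma> by (auto simp: pd_def)
  then obtain U a where U: "unitary n U" and \<sigma>s: "\<sigma> = spec n U (\<lambda>i. of_real (a i))"
    and fU: "\<And>f. mfun f \<sigma> = spec n U (\<lambda>i. of_real (f (a i)))"
    using mfun_spectral by metis
  have a: "0 < a i" if "i < n" for i using pd_spec_pos[OF U _ that] \<sigma>(2) \<sigma>s by metis
  define S where "S = spec n U (\<lambda>i. of_real (a i powr s))"
  have S: "S \<in> carrier_mat n n" "mat_adjoint S = S"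
    by (simp_all add: S_def spec_carrier[OF U] spec_adjoint[OF U])
  have P: "psd n (S * \<rho> * S)"
    using psd_conj[OF _ S(1), of \<rho>] \<rho> S by (simp add: density_def)
  then obtain V h where V: "unitary n V" and hs: "S * \<rho> * S = spec n V (\<lambda>i. of_real (h i))"
    and fV: "\<And>f. mfun f (S * \<rho> * S) = spec n V (\<lambda>i. of_real (f (h i)))"
    using mfun_spectral[OF psd_carrier psd_hermitian] by metis
  have h: "0 \<le> h i" if "i < n" for i using psd_spec_nonneg[OF V _ that] P hs by metis
  have "Re (mtrace (mfun (\<lambda>x. x powr \<alpha>) (mfun (\<lambda>x. x powr s) \<sigma> * \<rho> * mfun (\<lambda>x. x powr s) \<sigma>))) = (\<Sum>i<n. h i powr \<alpha>)"
    unfolding fU S_def[symmetric] fV by (simp add: mtrace_spec[OF V])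
  then show thesis using that[OF U V \<sigma>s a h] hs by (simp add: S_def)
qed

text \<open>For a positive test operator T, Cauchy--Schwarz bounds F^2 by tr (E \<rho>1 T) tr
  (\<rho>2 T^-1). Writing T as B t B, with t diagonal in the eigenbasis of the conjugated \<rho>2,
  turns the second factor into the sum of g i / t i, while interpolation bounds the first by a norm
  of t. A suitable t makes both factors powers of the trace for \<alpha>.\<close>

lemma fidelity_le_sandwiched_traces:
  assumes E: "channel d1 d2 E" and E\<sigma>: "E \<sigma>1 = \<sigma>2"
    and \<rho>1: "density d1 \<rho>1" and \<sigma>1: "density d1 \<sigma>1" "pd d1 \<sigma>1"
    and \<rho>2: "density d2 \<rho>2" and \<sigma>2: "density d2 \<sigma>2" "pd d2 \<sigma>2"
    and \<alpha>: "1 / 2 < \<alpha>" "\<alpha> < 1" and \<beta>: "\<beta> = \<alpha> / (2 * \<alpha> - 1)"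
  shows "(trace_norm (mfun sqrt (E \<rho>1) * mfun sqrt \<rho>2))\<^sup>2
    \<le> sandwiched_trace \<beta> \<rho>1 \<sigma>1 powr (1 / \<beta>) * sandwiched_trace \<alpha> \<rho>2 \<sigma>2 powr (1 / \<alpha>)"
    and "0 \<le> sandwiched_trace \<beta> \<rho>1 \<sigma>1" and "0 \<le> sandwiched_trace \<alpha> \<rho>2 \<sigma>2"
proof -
  define \<theta> where "\<theta> = (1 - \<alpha>) / \<alpha>"
  have \<theta>: "0 < \<theta>" "\<theta> < 1" using \<alpha> by (simp_all add: \<theta>_def field_simps)
  \<comment> \<open>All exponents expressed through \<theta>. The identity (1 - \<alpha>) / \<theta>
    = \<alpha> is what makes the optimiser below produce a sum of \<alpha>-th powers.\<close>
  have e\<beta>: "1 - \<theta> = 1 / \<beta>" and s\<beta>: "(1 - \<beta>) / (2 * \<beta>) = - (\<theta> / 2)" and s\<alpha>: "(1 - \<alpha>) / (2 * \<alpha>) = \<theta> / 2"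
    and e\<alpha>: "1 / \<alpha> = 1 + \<theta>" and \<theta>\<alpha>: "(1 - \<alpha>) * (1 / \<theta>) = \<alpha>"
    using \<alpha> by (simp_all add: \<theta>_def \<beta> divide_simps)
  have \<beta>0: "0 < \<beta>" using \<alpha> by (simp add: \<beta>)
  obtain U a V h where U: "unitary d1 U" and V: "unitary d1 V" and \<sigma>1s: "\<sigma>1 = spec d1 U (\<lambda>i. of_real (a i))"
    and a: "\<And>i. i < d1 \<Longrightarrow> 0 < a i" and h: "\<And>i. i < d1 \<Longrightarrow> 0 \<le> h i"
    and H: "spec d1 U (\<lambda>i. of_real (a i powr (- (\<theta> / 2)))) * \<rho>1 * spec d1 U (\<lambda>i. of_real (a i powr (- (\<theta> / 2))))
        = spec d1 V (\<lambda>i. of_real (h i))"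
    and Q1: "sandwiched_trace \<beta> \<rho>1 \<sigma>1 = (\<Sum>i<d1. h i powr \<beta>)"
    using mfun_powr_conj[OF \<sigma>1 \<rho>1, of "- (\<theta> / 2)" \<beta>] unfolding sandwiched_trace_def Let_def s\<beta> by metis
  obtain U' b W g where U': "unitary d2 U'" and W: "unitary d2 W" and \<sigma>2s: "\<sigma>2 = spec d2 U' (\<lambda>i. of_real (b i))"
    and b: "\<And>i. i < d2 \<Longrightarrow> 0 < b i" and g: "\<And>i. i < d2 \<Longrightarrow> 0 \<le> g i"
    and G: "spec d2 U' (\<lambda>i. of_real (b i powr (\<theta> / 2))) * \<rho>2 * spec d2 U' (\<lambda>i. of_real (b i powr (\<theta> / 2)))
        = spec d2 W (\<lambda>i. of_real (g i))"
    and Q2: "sandwiched_trace \<alpha> \<rho>2 \<sigma>2 = (\<Sum>i<d2. g i powr \<alpha>)"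
    using mfun_powr_conj[OF \<sigma>2 \<rho>2, of "\<theta> / 2" \<alpha>] unfolding sandwiched_trace_def Let_def s\<alpha> by metis
  show "0 \<le> sandwiched_trace \<beta> \<rho>1 \<sigma>1" "0 \<le> sandwiched_trace \<alpha> \<rho>2 \<sigma>2"
    unfolding Q1 Q2 by (auto intro: sum_nonneg)
  have d1: "0 < d1" and d2: "0 < d2"
    using \<rho>1 \<rho>2 by (auto simp: density_def psd_def mtrace_def intro!: Nat.gr0I)
  define \<tau> where "\<tau> = E \<rho>1"
  have \<tau>: "density d2 \<tau>" unfolding \<tau>_def by (rule channel_density[OF E \<rho>1])
  define R1 R2 where "R1 = mfun sqrt \<tau>" and "R2 = mfun sqrt \<rho>2"
  have R1: "psd d2 R1" "R1 * R1 = \<tau>" and R2: "psd d2 R2" "R2 * R2 = \<rho>2"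
    using \<tau> \<rho>2 mfun_sqrt by (auto simp: density_def R1_def R2_def)
  have Rh: "mat_adjoint R1 = R1" "mat_adjoint R2 = R2" using R1 R2 psd_hermitian by auto
  define A A' B B' where "A = spec d1 U (\<lambda>i. of_real (a i powr (\<theta> / 2)))"
    and "A' = spec d1 U (\<lambda>i. of_real (a i powr (- (\<theta> / 2))))"
    and "B = spec d2 U' (\<lambda>i. of_real (b i powr (- (\<theta> / 2))))"
    and "B' = spec d2 U' (\<lambda>i. of_real (b i powr (\<theta> / 2)))"
  have car [simp]: "\<tau> \<in> carrier_mat d2 d2" "R1 \<in> carrier_mat d2 d2" "R2 \<in> carrier_mat d2 d2"
    "A \<in> carrier_mat d1 d1" "A' \<in> carrier_mat d1 d1" "B \<in> carrier_mat d2 d2" "B' \<in> carrier_mat d2 d2"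
    "\<rho>1 \<in> carrier_mat d1 d1" "\<rho>2 \<in> carrier_mat d2 d2"
    using \<tau> \<rho>1 \<rho>2 R1 R2
    by (simp_all add: density_def psd_carrier A_def A'_def B_def B'_def spec_carrier[OF U] spec_carrier[OF U'])
  have [simp]: "spec d2 W c \<in> carrier_mat d2 d2" "spec d1 V c \<in> carrier_mat d1 d1" for c
    by (simp_all add: spec_carrier W V)
  have Bh: "mat_adjoint B = B" "mat_adjoint B' = B'" by (simp_all add: B_def B'_def spec_adjoint[OF U'])
  have AA': "A * A' = 1\<^sub>m d1" "A' * A = 1\<^sub>m d1"
    unfolding A_def A'_def using a
    by (auto intro!: spec_mult_eq_one[OF U] simp: powr_add[symmetric] a[THEN less_imp_neq, symmetric] simp flip: of_real_mult)
  have BB': "B * B' = 1\<^sub>m d2"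
    unfolding B_def B'_def using b
    by (auto intro!: spec_mult_eq_one[OF U'] simp: powr_add[symmetric] b[THEN less_imp_neq, symmetric] simp flip: of_real_mult)
  note assoc1 = assoc_mult_mat[of _ d1 d1 _ d1 _ d1] and assoc2 = assoc_mult_mat[of _ d2 d2 _ d2 _ d2]
  define F where "F = trace_norm (R1 * R2)"
  have F0: "0 \<le> F" unfolding F_def by (rule trace_norm_nonneg[of _ d2]) simp
  have \<rho>1s: "A * spec d1 V (\<lambda>i. of_real (h i)) * A = \<rho>1"
  proof -
    have "A * spec d1 V (\<lambda>i. of_real (h i)) * A = (A * A') * (\<rho>1 * (A' * A))"
      unfolding H[symmetric] A'_def[symmetric] by (simp add: assoc1)
    then show ?thesis by (simp add: AA' left_mult_one_mat[of _ d1 d1] right_mult_one_mat[of _ d1 d1])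
  qed
  \<comment> \<open>\<open>X t\<close> is the first factor, the expectation of the test operator B t
    B in the image state.\<close>
  define X where "X t = Re (mtrace (\<tau> * (B * spec d2 W (\<lambda>i. of_real (t i)) * B)))" for t
  define Q where "Q = (\<Sum>i<d1. h i powr \<beta>) powr (1 / \<beta>)"
  have X_le: "X t \<le> Q * (\<Sum>i<d2. t i powr (1 / \<theta>)) powr \<theta>" if t: "\<And>i. i < d2 \<Longrightarrow> 0 < t i" for t
  proof -
    define T where "T = B * spec d2 W (\<lambda>i. of_real (t i)) * B"
    have TC [simp]: "T \<in> carrier_mat d2 d2" by (simp add: T_def)
    define K where "K = Re (mtrace (E (A * A) * T))"
    \<comment> \<open>The shift of \<open>h\<close> by \<open>\<delta>\<close> adds
      \<open>\<delta>\<close> times \<open>A * A\<close> to \<rho>1, hence by linearity the error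
      \<open>\<delta> * K\<close>, which vanishes in the limit.\<close>
    have bound: "X t + \<delta> * K \<le> (\<Sum>i<d1. (h i + \<delta>) powr \<beta>) powr (1 / \<beta>) * (\<Sum>i<d2. t i powr (1 / \<theta>)) powr \<theta>"
      if \<delta>: "0 < \<delta>" for \<delta>
    proof -
      have "spec d1 V (\<lambda>i. of_real (h i + \<delta>)) = spec d1 V (\<lambda>i. of_real (h i)) + of_real \<delta> \<cdot>\<^sub>m 1\<^sub>m d1"
      proof -
        have "of_real \<delta> \<cdot>\<^sub>m 1\<^sub>m d1 = spec d1 V (\<lambda>i. of_real \<delta>)"
          using V mult_smult_distrib[of V d1 d1 "mat_adjoint V" d1 "of_real \<delta>"]
          by (intro eq_matI) (auto simp: spec_index[OF V] unitary_def spec_one[OF V, symmetric]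
            sum_distrib_left mult_ac carrier_matD[OF spec_carrier[OF V]])
        then show ?thesis by (simp add: spec_add[OF V])
      qed
      then have "A * spec d1 V (\<lambda>i. of_real (h i + \<delta>)) * A = A * (spec d1 V (\<lambda>i. of_real (h i)) + of_real \<delta> \<cdot>\<^sub>m 1\<^sub>m d1) * A"
        by simp
      also have "\<dots> = A * spec d1 V (\<lambda>i. of_real (h i)) * A + of_real \<delta> \<cdot>\<^sub>m (A * A)"
        by (simp add: mult_add_distrib_mat[of _ d1 d1 _ d1] add_mult_distrib_mat[of _ d1 d1 _ _ d1]
            mult_smult_distrib[of _ d1 d1 _ d1] mult_smult_assoc_mat[of _ d1 d1 _ d1] right_mult_one_mat[of _ d1 d1])
      also have "\<dots> = 1 \<cdot>\<^sub>m \<rho>1 + of_real \<delta> \<cdot>\<^sub>m (A * A)" unfolding \<rho>1s by (intro arg_cong2[of _ _ _ _ "(+)"]) auto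
      finally have "E (A * spec d1 V (\<lambda>i. of_real (h i + \<delta>)) * A) = 1 \<cdot>\<^sub>m \<tau> + of_real \<delta> \<cdot>\<^sub>m E (A * A)"
        by (simp add: channel_linear[OF E] \<tau>_def)
      then have "mtrace (E (A * spec d1 V (\<lambda>i. of_real (h i + \<delta>)) * A) * T)
          = mtrace (\<tau> * T) + of_real \<delta> * mtrace (E (A * A) * T)"
        by (simp add: channel_carrier[OF E] add_mult_distrib_mat[of _ d2 d2 _ _ d2] mtrace_add[of _ d2]
            mult_smult_assoc_mat[of _ d2 d2 _ d2] mtrace_smult[of _ d2])
      then have "X t + \<delta> * K = Re (mtrace (E (A * spec d1 V (\<lambda>i. of_real (h i + \<delta>)) * A) * T))"
        by (simp add: X_def K_def T_def)
      also have "\<dots> \<le> (\<Sum>i<d1. (h i + \<delta>) powr (1 / (1 - \<theta>))) powr (1 - \<theta>) * (\<Sum>i<d2. t i powr (1 / \<theta>)) powr \<theta>"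
        unfolding T_def A_def B_def
        using h \<delta> E\<sigma> by (intro channel_interpolation[OF E U V U' W a _ b t _ \<theta> d1 d2])
          (auto simp: \<sigma>1s \<sigma>2s add_nonneg_pos)
      finally show ?thesis using \<beta>0 by (simp add: e\<beta>)
    qed
    have "((\<lambda>\<delta>. (\<Sum>i<d1. (h i + \<delta>) powr \<beta>) powr (1 / \<beta>) * (\<Sum>i<d2. t i powr (1 / \<theta>)) powr \<theta> - \<delta> * K)
        \<longlongrightarrow> (\<Sum>i<d1. (h i + 0) powr \<beta>) powr (1 / \<beta>) * (\<Sum>i<d2. t i powr (1 / \<theta>)) powr \<theta> - 0 * K) (at_right 0)"
      using \<beta>0 h
      by (intro tendsto_intros tendsto_powr' tendsto_sum)
         (auto intro!: sum_nonneg eventually_at_right_less[THEN eventually_mono] add_nonneg_nonneg)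
    then have "X t \<le> (\<Sum>i<d1. (h i + 0) powr \<beta>) powr (1 / \<beta>) * (\<Sum>i<d2. t i powr (1 / \<theta>)) powr \<theta> - 0 * K"
      by (rule tendsto_lowerbound) (auto simp: eventually_at_right_field le_diff_eq intro!: exI[of _ 1] bound)
    then show ?thesis by (simp add: Q_def)
  qed
  have F_le: "2 * F \<le> X t + (\<Sum>i<d2. g i / t i)" if t: "\<And>i. i < d2 \<Longrightarrow> 0 < t i" for t
  proof -
    define C C' where "C = spec d2 W (\<lambda>i. of_real (sqrt (t i)))" and "C' = spec d2 W (\<lambda>i. of_real (1 / sqrt (t i)))"
    have [simp]: "C \<in> carrier_mat d2 d2" "C' \<in> carrier_mat d2 d2" by (simp_all add: C_def C'_def)
    have Ch: "mat_adjoint C = C" "mat_adjoint C' = C'" by (simp_all add: C_def C'_def spec_adjoint[OF W])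
    have CC': "C * C' = 1\<^sub>m d2"
      unfolding C_def C'_def by (intro spec_mult_eq_one[OF W]) (auto dest: t simp flip: of_real_mult)
    have CC: "C * C = spec d2 W (\<lambda>i. of_real (t i))"
      unfolding C_def spec_mult[OF W] by (intro spec_cong[OF W]) (auto dest: t simp flip: of_real_mult)
    have C'C': "C' * C' = spec d2 W (\<lambda>i. of_real (1 / t i))"
      unfolding C'_def spec_mult[OF W] by (intro spec_cong[OF W]) (auto dest: t simp flip: of_real_mult)
    \<comment> \<open>The square root of the test operator and its inverse are inserted between the
      two roots of the states; the two squared norms then involve T and T^-1.\<close>
    have "(R1 * (B * C)) * ((C' * B') * R2) = R1 * (B * (C * C') * B') * R2"
      by (simp add: assoc2)
    also have "\<dots> = R1 * R2" by (simp add: CC' BB' right_mult_one_mat[of _ d2 d2])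
    finally have "2 * F \<le> Re (mtrace ((R1 * (B * C)) * mat_adjoint (R1 * (B * C))))
        + Re (mtrace (mat_adjoint ((C' * B') * R2) * ((C' * B') * R2)))"
      using trace_norm_mult_le[of "R1 * (B * C)" d2 "(C' * B') * R2"] by (simp add: F_def)
    also have "mtrace ((R1 * (B * C)) * mat_adjoint (R1 * (B * C))) = mtrace (R1 * (B * (C * C) * B * R1))"
      by (simp add: adjoint_mult[of _ d2 d2 _ d2] Ch Bh Rh assoc2)
    also have "\<dots> = mtrace (B * (C * C) * B * R1 * R1)" by (rule mtrace_comm[of _ d2 d2]) simp_all
    also have "\<dots> = mtrace ((B * (C * C) * B) * \<tau>)" unfolding R1(2)[symmetric] by (simp add: assoc2)
    also have "\<dots> = mtrace (\<tau> * (B * (C * C) * B))" by (rule mtrace_comm[of _ d2 d2]) simp_all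
    also have "Re \<dots> = X t" by (simp add: X_def CC)
    also have "mtrace (mat_adjoint ((C' * B') * R2) * ((C' * B') * R2)) = mtrace (((C' * B') * R2) * mat_adjoint ((C' * B') * R2))"
      by (rule mtrace_comm[of _ d2 d2]) simp_all
    also have "\<dots> = mtrace (C' * ((B' * \<rho>2 * B') * C'))"
      unfolding R2(2)[symmetric] by (simp add: adjoint_mult[of _ d2 d2 _ d2] Ch Bh Rh assoc2)
    also have "\<dots> = mtrace ((B' * \<rho>2 * B') * C' * C')" by (rule mtrace_comm[of _ d2 d2]) simp_all
    also have "\<dots> = mtrace ((B' * \<rho>2 * B') * (C' * C'))" by (simp add: assoc2)
    also have "\<dots> = of_real (\<Sum>i<d2. g i / t i)"
      unfolding B'_def G C'C' spec_mult[OF W] mtrace_spec[OF W] by simp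
    finally show ?thesis by simp
  qed
  have Q0: "0 \<le> Q" by (simp add: Q_def)
  \<comment> \<open>\<open>\<epsilon>\<close> keeps the test operator positive definite on the
    kernel of the conjugated \<rho>2.\<close>
  have bound: "F\<^sup>2 \<le> Q * (\<Sum>i<d2. (g i + \<epsilon>) powr \<alpha>) powr \<theta> * (\<Sum>i<d2. g i powr \<alpha>)" if \<epsilon>: "0 < \<epsilon>" for \<epsilon>
  proof (rule square_le_of_scaled_sum[OF F0])
    show "0 \<le> Q * (\<Sum>i<d2. (g i + \<epsilon>) powr \<alpha>) powr \<theta>" using Q0 by simp
    show "0 \<le> (\<Sum>i<d2. g i powr \<alpha>)" by (intro sum_nonneg) simp
    fix c :: real assume c: "0 < c"
    \<comment> \<open>The exponent 1 - \<alpha> makes t^(1/\<theta>) proportional to (g +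
      \<epsilon>)^\<alpha> and bounds g / t by g^\<alpha> / c. The free scale \<open>c\<close> turns
      the sum of the two factors into their product.\<close>
    define t where "t i = c * (g i + \<epsilon>) powr (1 - \<alpha>)" for i
    have ge: "0 < g i + \<epsilon>" if "i < d2" for i using g[OF that] \<epsilon> by simp
    have t: "0 < t i" if "i < d2" for i using c ge[OF that] by (simp add: t_def)
    have "(\<Sum>i<d2. t i powr (1 / \<theta>)) = c powr (1 / \<theta>) * (\<Sum>i<d2. (g i + \<epsilon>) powr \<alpha>)"
      unfolding t_def sum_distrib_left using c \<theta>\<alpha>
      by (intro sum.cong refl) (simp add: powr_mult powr_powr del: times_divide_eq_right)
    then have "(\<Sum>i<d2. t i powr (1 / \<theta>)) powr \<theta> = c * (\<Sum>i<d2. (g i + \<epsilon>) powr \<alpha>) powr \<theta>"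
      using c \<theta> by (simp add: powr_mult powr_powr sum_nonneg)
    then have "X t \<le> c * (Q * (\<Sum>i<d2. (g i + \<epsilon>) powr \<alpha>) powr \<theta>)"
      using X_le[of t, OF t] by (simp add: mult_ac)
    moreover have "(\<Sum>i<d2. g i / t i) \<le> (\<Sum>i<d2. g i powr \<alpha> / c)"
    proof (rule sum_mono)
      fix i assume "i \<in> {..<d2}"
      then have i: "i < d2" by simp
      have "g i \<le> g i powr \<alpha> * (g i + \<epsilon>) powr (1 - \<alpha>)"
      proof (cases "g i = 0")
        case False
        then have gi: "0 < g i" using g[OF i] by simp
        have "g i = g i powr \<alpha> * g i powr (1 - \<alpha>)" using gi by (simp add: powr_add[symmetric])
        also have "\<dots> \<le> g i powr \<alpha> * (g i + \<epsilon>) powr (1 - \<alpha>)"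
          using gi \<epsilon> \<alpha> by (intro mult_left_mono powr_mono2) auto
        finally show ?thesis .
      qed simp
      then show "g i / t i \<le> g i powr \<alpha> / c"
        using t[OF i] c by (simp add: t_def divide_simps mult_ac)
    qed
    ultimately show "2 * F \<le> c * (Q * (\<Sum>i<d2. (g i + \<epsilon>) powr \<alpha>) powr \<theta>) + (\<Sum>i<d2. g i powr \<alpha>) / c"
      using F_le[of t, OF t] by (simp add: sum_divide_distrib)
  qed
  have "((\<lambda>\<epsilon>. Q * (\<Sum>i<d2. (g i + \<epsilon>) powr \<alpha>) powr \<theta> * (\<Sum>i<d2. g i powr \<alpha>))
      \<longlongrightarrow> Q * (\<Sum>i<d2. (g i + 0) powr \<alpha>) powr \<theta> * (\<Sum>i<d2. g i powr \<alpha>)) (at_right 0)"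
    using \<alpha> \<theta> g
    by (intro tendsto_intros tendsto_powr' tendsto_sum)
       (auto intro!: sum_nonneg eventually_at_right_less[THEN eventually_mono] add_nonneg_nonneg)
  then have "F\<^sup>2 \<le> Q * (\<Sum>i<d2. (g i + 0) powr \<alpha>) powr \<theta> * (\<Sum>i<d2. g i powr \<alpha>)"
    by (rule tendsto_lowerbound) (auto simp: eventually_at_right_field intro!: exI[of _ 1] bound)
  \<comment> \<open>The exponents \<theta> and 1 add up to 1/\<alpha>; a vanishing sum is treated
    apart because \<open>powr\<close> sends base 0 to 0.\<close>
  also have "\<dots> = Q * (\<Sum>i<d2. g i powr \<alpha>) powr (1 / \<alpha>)"
    using sum_nonneg[of "{..<d2}" "\<lambda>i. g i powr \<alpha>"]
    by (cases "(\<Sum>i<d2. g i powr \<alpha>) = 0") (auto simp: e\<alpha> powr_add)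
  finally show "(trace_norm (mfun sqrt (E \<rho>1) * mfun sqrt \<rho>2))\<^sup>2
    \<le> sandwiched_trace \<beta> \<rho>1 \<sigma>1 powr (1 / \<beta>) * sandwiched_trace \<alpha> \<rho>2 \<sigma>2 powr (1 / \<alpha>)"
    by (simp add: Q1 Q2 Q_def F_def R1_def R2_def \<tau>_def)
qed

text \<open>Here 1/\<beta> = \<theta> / (\<beta> - 1) and 1/\<alpha> = -\<theta> / (\<alpha> - 1),
  so the prefactors of the two divergences turn into \<theta> and -\<theta>.\<close>

lemma fidelity_le_sandwiched:
  assumes E: "channel d1 d2 E" and E\<sigma>: "E \<sigma>1 = \<sigma>2"
    and \<rho>1: "density d1 \<rho>1" and \<sigma>1: "density d1 \<sigma>1" "pd d1 \<sigma>1"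
    and \<rho>2: "density d2 \<rho>2" and \<sigma>2: "density d2 \<sigma>2" "pd d2 \<sigma>2"
    and \<alpha>: "1 / 2 < \<alpha>" "\<alpha> < 1" and \<beta>: "\<beta> = \<alpha> / (2 * \<alpha> - 1)"
  shows "(trace_norm (mfun sqrt (E \<rho>1) * mfun sqrt \<rho>2))\<^sup>2
    \<le> 2 powr ((1 - \<alpha>) / \<alpha> * (sandwiched \<beta> \<rho>1 \<sigma>1 - sandwiched \<alpha> \<rho>2 \<sigma>2))"
proof -
  define q1 q2 where "q1 = sandwiched_trace \<beta> \<rho>1 \<sigma>1" and "q2 = sandwiched_trace \<alpha> \<rho>2 \<sigma>2"
  have le: "(trace_norm (mfun sqrt (E \<rho>1) * mfun sqrt \<rho>2))\<^sup>2 \<le> q1 powr (1 / \<beta>) * q2 powr (1 / \<alpha>)"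
    and q: "0 \<le> q1" "0 \<le> q2"
    unfolding q1_def q2_def using fidelity_le_sandwiched_traces[OF assms] by auto
  show ?thesis
  proof (cases "q1 = 0 \<or> q2 = 0")
    \<comment> \<open>The logarithm of 0 has the default value 0, so the divergences say nothing
      here; instead the product bound already forces the fidelity to vanish.\<close>
    case True
    then have "(trace_norm (mfun sqrt (E \<rho>1) * mfun sqrt \<rho>2))\<^sup>2 \<le> 0" using le by auto
    then show ?thesis by (rule order_trans) simp
  next
    case False
    then have q: "0 < q1" "0 < q2" using q by auto
    have "\<beta> \<noteq> 1" "0 < \<beta>" "1 / \<beta> = (1 - \<alpha>) / \<alpha> / (\<beta> - 1)"
      using \<alpha> by (simp_all add: \<beta> divide_simps)
    moreover have "1 / \<alpha> = - ((1 - \<alpha>) / \<alpha> / (\<alpha> - 1))" using \<alpha> by (simp add: divide_simps)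
    ultimately have "q1 powr (1 / \<beta>) * q2 powr (1 / \<alpha>)
        = 2 powr ((1 - \<alpha>) / \<alpha> * (sandwiched \<beta> \<rho>1 \<sigma>1)) * 2 powr (- ((1 - \<alpha>) / \<alpha> * sandwiched \<alpha> \<rho>2 \<sigma>2))"
      using \<alpha> q by (simp add: sandwiched_eq q1_def[symmetric] q2_def[symmetric] powr_def log_def)
    then show ?thesis using le by (simp add: powr_add[symmetric] algebra_simps)
  qed
qed

section \<open>From the one-shot bound to an exponential rate\<close>

theorem theorem2:
  fixes d1 d2 :: "nat \<Rightarrow> nat"
    and \<rho>1 \<sigma>1 \<rho>2 \<sigma>2 :: "nat \<Rightarrow> complex mat"
    and \<Delta> :: "complex mat \<Rightarrow> complex mat \<Rightarrow> real"
  assumes states1: "\<And>n. density (d1 n) (\<rho>1 n) \<and> density (d1 n) (\<sigma>1 n)"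
    and states2: "\<And>n. density (d2 n) (\<rho>2 n) \<and> density (d2 n) (\<sigma>2 n)"
    and fullsupp: "\<And>n. pd (d1 n) (\<sigma>1 n) \<and> pd (d2 n) (\<sigma>2 n)"
    and conv1: "\<And>\<alpha>. \<alpha> \<ge> 1/2 \<Longrightarrow> convergent (\<lambda>n. sandwiched \<alpha> (\<rho>1 n) (\<sigma>1 n) / real n)"
    and conv2: "\<And>\<alpha>. \<alpha> \<ge> 1/2 \<Longrightarrow> convergent (\<lambda>n. sandwiched \<alpha> (\<rho>2 n) (\<sigma>2 n) / real n)"
    and cont1: "continuous (at 1 within {1/2..}) (\<lambda>\<alpha>. reg_div \<alpha> \<rho>1 \<sigma>1)"
    and cont2: "continuous (at 1 within {1/2..}) (\<lambda>\<alpha>. reg_div \<alpha> \<rho>2 \<sigma>2)"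
    and less: "reg_div 1 \<rho>1 \<sigma>1 < reg_div 1 \<rho>2 \<sigma>2"
    and Delta: "\<Delta> = trace_dist \<or> \<Delta> = purified_dist"
  shows "\<exists>\<gamma>>0. \<forall>\<E> :: nat \<Rightarrow> complex mat \<Rightarrow> complex mat.
           (\<forall>n. channel (d1 n) (d2 n) (\<E> n) \<and> \<E> n (\<sigma>1 n) = \<sigma>2 n) \<longrightarrow>
           (\<exists>n0. \<forall>n\<ge>n0. \<Delta> (\<E> n (\<rho>1 n)) (\<rho>2 n) \<ge> 1 - 2 powr (- \<gamma> * real n))"
proof -
  define gap where "gap = reg_div 1 \<rho>2 \<sigma>2 - reg_div 1 \<rho>1 \<sigma>1"
  have gap: "0 < gap" using less by (simp add: gap_def)
  obtain r1 where r1: "0 < r1" "\<And>x. 1/2 \<le> x \<Longrightarrow> \<bar>x - 1\<bar> < r1 \<Longrightarrow> \<bar>reg_div x \<rho>1 \<sigma>1 - reg_div 1 \<rho>1 \<sigma>1\<bar> < gap / 4"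
    using cont1 gap unfolding continuous_within_eps_delta dist_real_def
    by (metis atLeast_iff zero_less_divide_iff zero_less_numeral)
  obtain r2 where r2: "0 < r2" "\<And>x. 1/2 \<le> x \<Longrightarrow> \<bar>x - 1\<bar> < r2 \<Longrightarrow> \<bar>reg_div x \<rho>2 \<sigma>2 - reg_div 1 \<rho>2 \<sigma>2\<bar> < gap / 4"
    using cont2 gap unfolding continuous_within_eps_delta dist_real_def
    by (metis atLeast_iff zero_less_divide_iff zero_less_numeral)
  \<comment> \<open>\<eta> \<le> 1/4 keeps \<alpha> above 1/2 and gives \<beta> - 1 \<le> 2\<eta>;
    the factor 4 then puts both \<alpha> and \<beta> strictly inside the two continuity
    radii.\<close>
  define \<eta> where "\<eta> = min (1/4) (min r1 r2 / 4)"
  have \<eta>: "0 < \<eta>" "\<eta> \<le> 1/4" "4 * \<eta> \<le> r1" "4 * \<eta> \<le> r2" using r1 r2 by (auto simp: \<eta>_def min_def)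
  define \<alpha> \<beta> where "\<alpha> = 1 - \<eta>" and "\<beta> = \<alpha> / (2 * \<alpha> - 1)"
  have \<alpha>: "1/2 < \<alpha>" "\<alpha> < 1" using \<eta> by (simp_all add: \<alpha>_def)
  have "\<beta> - 1 = \<eta> / (1 - 2 * \<eta>)" using \<eta> by (simp add: \<beta>_def \<alpha>_def field_simps)
  moreover have "\<eta> / (1 - 2 * \<eta>) \<le> 2 * \<eta>" using \<eta> by (simp add: divide_le_eq field_simps)
  moreover have "0 < \<eta> / (1 - 2 * \<eta>)" using \<eta> by simp
  ultimately have \<beta>: "1 < \<beta>" "\<beta> - 1 \<le> 2 * \<eta>" by linarith+
  define \<theta> where "\<theta> = (1 - \<alpha>) / \<alpha>"
  have \<theta>: "0 < \<theta>" using \<alpha> by (simp add: \<theta>_def)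
  \<comment> \<open>On each side continuity costs gap/4 and convergence in n costs gap/8, so gap/4
    of the difference remains. The bound on F^2 therefore has exponent -\<theta> n gap/4 =
    -2\<gamma>n.\<close>
  define \<gamma> where "\<gamma> = \<theta> * gap / 8"
  have \<gamma>: "0 < \<gamma>" using \<theta> gap by (simp add: \<gamma>_def)
  have "reg_div \<beta> \<rho>1 \<sigma>1 < reg_div 1 \<rho>1 \<sigma>1 + gap / 4" using r1(2)[of \<beta>] \<beta> \<eta> by linarith
  moreover have "(\<lambda>n. sandwiched \<beta> (\<rho>1 n) (\<sigma>1 n) / real n) \<longlonglongrightarrow> reg_div \<beta> \<rho>1 \<sigma>1"
    using conv1[of \<beta>] \<beta> by (simp add: convergent_LIMSEQ_iff reg_div_def)
  ultimately have ev1: "\<forall>\<^sub>F n in sequentially. sandwiched \<beta> (\<rho>1 n) (\<sigma>1 n) / real n < reg_div 1 \<rho>1 \<sigma>1 + gap / 4 + gap / 8"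
    using gap by (intro order_tendstoD) auto
  have "reg_div \<alpha> \<rho>2 \<sigma>2 > reg_div 1 \<rho>2 \<sigma>2 - gap / 4" using r2(2)[of \<alpha>] \<alpha> \<eta> \<alpha>_def by linarith
  moreover have "(\<lambda>n. sandwiched \<alpha> (\<rho>2 n) (\<sigma>2 n) / real n) \<longlonglongrightarrow> reg_div \<alpha> \<rho>2 \<sigma>2"
    using conv2[of \<alpha>] \<alpha> by (simp add: convergent_LIMSEQ_iff reg_div_def)
  ultimately have ev2: "\<forall>\<^sub>F n in sequentially. sandwiched \<alpha> (\<rho>2 n) (\<sigma>2 n) / real n > reg_div 1 \<rho>2 \<sigma>2 - gap / 4 - gap / 8"
    using gap by (intro order_tendstoD) auto
  have "\<forall>\<^sub>F n in sequentially. n > 0 \<and> sandwiched \<beta> (\<rho>1 n) (\<sigma>1 n) - sandwiched \<alpha> (\<rho>2 n) (\<sigma>2 n) \<le> - (gap / 4) * real n"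
    using ev1 ev2 eventually_gt_at_top[of 0]
  proof eventually_elim
    case (elim n)
    have "u - v \<le> - (gap / 4)"
      if "u < reg_div 1 \<rho>1 \<sigma>1 + gap / 4 + gap / 8" "reg_div 1 \<rho>2 \<sigma>2 - gap / 4 - gap / 8 < v" for u v
      using that gap_def by linarith
    from this[OF elim(1,2)] have "sandwiched \<beta> (\<rho>1 n) (\<sigma>1 n) / real n - sandwiched \<alpha> (\<rho>2 n) (\<sigma>2 n) / real n \<le> - (gap / 4)" .
    then have "(sandwiched \<beta> (\<rho>1 n) (\<sigma>1 n) - sandwiched \<alpha> (\<rho>2 n) (\<sigma>2 n)) / real n \<le> - (gap / 4)"
      by (simp only: diff_divide_distrib)
    then show ?case using elim(3) pos_divide_le_eq[of "real n"] by (metis of_nat_0_less_iff)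
  qed
  \<comment> \<open>\<open>n0\<close> is obtained from the states alone, so the same threshold works
    for all channels.\<close>
  then obtain n0 where n0: "\<And>n. n \<ge> n0 \<Longrightarrow> sandwiched \<beta> (\<rho>1 n) (\<sigma>1 n) - sandwiched \<alpha> (\<rho>2 n) (\<sigma>2 n) \<le> - (gap / 4) * real n"
    by (auto simp: eventually_sequentially)
  have main: "\<Delta> (\<E> n (\<rho>1 n)) (\<rho>2 n) \<ge> 1 - 2 powr (- \<gamma> * real n)"
    if \<E>: "channel (d1 n) (d2 n) (\<E> n) \<and> \<E> n (\<sigma>1 n) = \<sigma>2 n" and n: "n \<ge> n0" for \<E> n
  proof -
    define F where "F = trace_norm (mfun sqrt (\<E> n (\<rho>1 n)) * mfun sqrt (\<rho>2 n))"
    define x where "x = 2 powr (- \<gamma> * real n)"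
    have "x \<le> 2 powr 0" unfolding x_def using \<gamma> by (intro powr_mono) auto
    then have x: "0 < x" "x \<le> 1" by (simp_all add: x_def)
    have "F\<^sup>2 \<le> 2 powr (\<theta> * (sandwiched \<beta> (\<rho>1 n) (\<sigma>1 n) - sandwiched \<alpha> (\<rho>2 n) (\<sigma>2 n)))"
      unfolding F_def \<theta>_def using \<E> states1[of n] states2[of n] fullsupp[of n] \<alpha>
      by (intro fidelity_le_sandwiched) (auto simp: \<beta>_def)
    also have "\<dots> \<le> 2 powr (\<theta> * (- (gap / 4) * real n))"
      using n0[OF n] \<theta> by (intro powr_mono mult_left_mono) auto
    also have "\<dots> = x\<^sup>2" by (simp add: x_def \<gamma>_def power2_eq_square powr_add[symmetric])
    finally have F2: "F\<^sup>2 \<le> x\<^sup>2" .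
    have "x\<^sup>2 \<le> x" using x by (simp add: power2_eq_square mult_left_le)
    from Delta show ?thesis
    proof
      assume "\<Delta> = trace_dist"
      moreover have "1 - F \<le> trace_dist (\<E> n (\<rho>1 n)) (\<rho>2 n)"
        unfolding F_def using \<E> states1[of n] states2[of n]
        by (intro trace_dist_ge_one_minus_fidelity[of "d2 n"]) (auto intro: channel_density)
      moreover have "F \<le> x" using F2 x by (intro power2_le_imp_le[OF F2]) simp
      ultimately show ?thesis by (simp add: x_def)
    next
      assume "\<Delta> = purified_dist"
      moreover have "1 - x \<le> sqrt (1 - F\<^sup>2)"
      proof (rule real_le_rsqrt)
        \<comment> \<open>For the purified distance the chain is (1 - x)^2 \<le> 1 - x \<le> 1 - x^2
          \<le> 1 - F^2, where x lies between 0 and 1.\<close>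
        have "(1 - x)\<^sup>2 = 1 - x - x * (1 - x)" by (simp add: power2_eq_square algebra_simps)
        also have "\<dots> \<le> 1 - x" using x by simp
        also have "\<dots> \<le> 1 - F\<^sup>2" using F2 \<open>x\<^sup>2 \<le> x\<close> by simp
        finally show "(1 - x)\<^sup>2 \<le> 1 - F\<^sup>2" .
      qed
      ultimately show ?thesis by (simp add: x_def purified_dist_def F_def)
    qed
  qed
  show ?thesis using \<gamma> main by blast
qed

end
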